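(* Let $p>3$ be a prime and, for $n\ge 0$, let $f_n=\sum_{k=0}^n\binom{n}{k}^3$ denote the $n$th Franel number. Then $$\sum_{k=0}^{p-1}\binom{2k}{k}\frac{3k+1}{(-16)^k}f_k\equiv(-1)^{(p-1)/2}p+p^3E_{p-3}\pmod{p^4},$$ where $E_{p-3}$ is the $(p-3)$th Euler number.
   Context: The Euler numbers $E_n$ are defined by $\frac{2e^t}{e^{2t}+1}=\sum_{n=0}^\infty E_n\frac{t^n}{n!}$ for $|t|<\pi/2$. A congruence $a\equiv b\pmod{p^m}$ between rational numbers whose denominators are coprime to $p$ means that $(a-b)/p^m$ is a rational number whose denominator is coprime to $p$. *)

theory Defs
  imports "HOL-Complex_Analysis.Complex_Analysis"
begin

definition franel :: "nat \<Rightarrow> nat" where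
  "franel n = (\<Sum>k=0..n. (n choose k) ^ 3)"

(* The definite description is justified by euler_number_ex1 below. *)
definition euler_number :: "nat \<Rightarrow> rat" where
  "euler_number = (THE E. \<forall>t::complex. norm t < pi / 2 \<longrightarrow>
      (\<lambda>n. of_rat (E n) * (t ^ n / fact n)) sums (2 * exp t / (exp (2 * t) + 1)))"

definition denom_coprime :: "nat \<Rightarrow> rat \<Rightarrow> bool" where
  "denom_coprime p x \<longleftrightarrow> coprime (snd (quotient_of x)) (int p)"

(* a = b (mod p^m).  The first two conjuncts are the proviso under which the
   congruence is meaningful. *)
definition rat_cong :: "nat \<Rightarrow> nat \<Rightarrow> rat \<Rightarrow> rat \<Rightarrow> bool" where
  "rat_cong p m a b \<longleftrightarrow>
     denom_coprime p a \<and> denom_coprime p b \<and> denom_coprime p ((a - b) / of_nat p ^ m)"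

lemma exp_double_plus_one_nonzero:
  fixes z :: complex
  assumes "norm z < pi / 2"
  shows "exp (2 * z) + 1 \<noteq> 0"
proof
  assume "exp (2 * z) + 1 = 0"
  hence e: "exp (2 * z) = -1" by (simp add: eq_neg_iff_add_eq_0)
  also have "\<dots> = exp (\<i> * of_real pi)" by simp
  finally obtain n :: int where n: "2 * z = \<i> * of_real pi + (of_int (2 * n) * pi) * \<i>"
    unfolding exp_eq by blast
  hence "Im (2 * z) = (2 * of_int n + 1) * pi" by (simp add: algebra_simps)
  hence "\<bar>2 * Im z\<bar> = \<bar>real_of_int (2 * n + 1)\<bar> * pi" by (simp add: abs_mult)
  moreover have "1 \<le> \<bar>2 * n + 1\<bar>" by presburger
  hence "1 \<le> \<bar>real_of_int (2 * n + 1)\<bar>" by linarith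
  hence "1 * pi \<le> \<bar>real_of_int (2 * n + 1)\<bar> * pi" by (intro mult_right_mono) auto
  ultimately have "pi \<le> \<bar>2 * Im z\<bar>" by linarith
  hence "pi \<le> 2 * \<bar>Im z\<bar>" by (simp add: abs_mult)
  with abs_Im_le_cmod[of z] assms show False by simp
qed

definition euler_fps :: "'a::field_char_0 fps" where
  "euler_fps = 2 * fps_exp 1 / (fps_exp 2 + 1)"

lemma euler_fps_mult: "(euler_fps :: 'a::field_char_0 fps) * (fps_exp 2 + 1) = 2 * fps_exp 1"
proof -
  have "fps_nth (fps_exp 2 + 1 :: 'a fps) 0 \<noteq> 0" by simp
  hence "is_unit (fps_exp 2 + 1 :: 'a fps)" by (simp only: fps_is_unit_iff not_False_eq_True)
  thus ?thesis unfolding euler_fps_def by simp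
qed

lemma of_rat_fact: "of_rat (fact n) = (fact n :: 'a::field_char_0)"
  by (metis of_nat_fact of_rat_of_nat_eq)

lemma fps_nth_euler_fps_complex:
  "fps_nth (euler_fps :: complex fps) n = of_rat (fps_nth euler_fps n)"
proof -
  let ?D = "fps_exp 2 + 1 :: complex fps"
  let ?F = "Abs_fps (\<lambda>n. of_rat (fps_nth euler_fps n)) :: complex fps"
  have D: "fps_nth ?D n = of_rat (fps_nth (fps_exp 2 + 1) n)" for n
    by (simp add: of_rat_divide of_rat_power of_rat_add of_rat_fact)
  have "?F * ?D = 2 * fps_exp 1"
  proof (rule fps_ext)
    fix n
    have "fps_nth (?F * ?D) n = of_rat (fps_nth (euler_fps * (fps_exp 2 + 1)) n)"
      unfolding fps_mult_nth D by (simp add: of_rat_sum of_rat_mult)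
    also have "\<dots> = fps_nth (2 * fps_exp 1) n"
      unfolding euler_fps_mult by (simp add: numeral_fps_const of_rat_divide of_rat_mult of_rat_fact)
    finally show "fps_nth (?F * ?D) n = fps_nth (2 * fps_exp 1) n" .
  qed
  also have "\<dots> = euler_fps * ?D" by (simp add: euler_fps_mult)
  finally have "?F * ?D = euler_fps * ?D" .
  moreover have "fps_nth ?D 0 \<noteq> 0" by simp
  hence "?D \<noteq> 0" by (metis fps_zero_nth)
  ultimately have "?F = euler_fps" by simp
  thus ?thesis by (metis fps_nth_Abs_fps)
qed

lemma euler_fps_sums:
  fixes t :: complex
  assumes "norm t < pi / 2"
  shows "(\<lambda>n. of_rat (fact n * fps_nth euler_fps n) * (t ^ n / fact n))
           sums (2 * exp t / (exp (2 * t) + 1))"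
proof -
  let ?f = "\<lambda>z::complex. 2 * exp z / (exp (2 * z) + 1)"
  have "fps_nth (fps_exp 2 + 1 :: complex fps) 0 \<noteq> 0" by simp
  hence "?f has_fps_expansion euler_fps"
    unfolding euler_fps_def
    by (intro fps_expansion_intros) (use has_fps_expansion_exp[of "1::complex"] in \<open>auto\<close>)
  hence c: "fps_nth euler_fps n = (deriv ^^ n) ?f 0 / fact n" for n
    by (rule fps_nth_fps_expansion)
  have "?f holomorphic_on ball 0 (pi / 2)"
    by (intro holomorphic_intros) (auto simp: exp_double_plus_one_nonzero)
  hence "(\<lambda>n. (deriv ^^ n) ?f 0 / fact n * (t - 0) ^ n) sums ?f t"
    by (rule holomorphic_power_series) (use assms in auto)
  thus ?thesis
    by (simp add: c[symmetric] fps_nth_euler_fps_complex of_rat_mult of_rat_fact)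
qed

lemma euler_number_ex1:
  "\<exists>!E. \<forall>t::complex. norm t < pi / 2 \<longrightarrow>
      (\<lambda>n. of_rat (E n) * (t ^ n / fact n)) sums (2 * exp t / (exp (2 * t) + 1))"
  (is "\<exists>!E. ?P E")
proof (rule ex1I)
  show "?P (\<lambda>n. fact n * fps_nth euler_fps n)" using euler_fps_sums by blast
next
  fix E assume E: "?P E"
  let ?f = "\<lambda>z::complex. 2 * exp z / (exp (2 * z) + 1)"
  have sums_nhds: "\<forall>\<^sub>F t in nhds 0. (\<lambda>n. fps_nth (Abs_fps (\<lambda>n. of_rat (G n) / fact n)) n * t ^ n) sums ?f t"
    if "?P G" for G
  proof -
    have "\<forall>\<^sub>F t::complex in nhds 0. t \<in> ball 0 (pi / 2)"
      by (intro eventually_nhds_in_open) auto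
    thus ?thesis by eventually_elim (use that in auto)
  qed
  have exp: "?f has_fps_expansion Abs_fps (\<lambda>n. of_rat (G n) / fact n)" if "?P G" for G
    by (rule has_fps_expansionI[OF sums_nhds[OF that]])
  show "E = (\<lambda>n. fact n * fps_nth euler_fps n)"
  proof
    fix n
    have "of_rat (E n) / fact n = (deriv ^^ n) ?f 0 / fact n"
      using fps_nth_fps_expansion[OF exp[OF E], of n] by simp
    also have "\<dots> = of_rat (fact n * fps_nth euler_fps n) / fact n"
      using fps_nth_fps_expansion[OF exp[of "\<lambda>n. fact n * fps_nth euler_fps n"], of n]
        euler_fps_sums by simp
    finally show "E n = fact n * fps_nth euler_fps n"
      by (simp add: of_rat_eq_iff)
  qed
qed

lemma euler_number_eq: "euler_number n = fact n * fps_nth euler_fps n"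
proof -
  have "euler_number = (\<lambda>n. fact n * fps_nth euler_fps n)"
    unfolding euler_number_def
    using euler_fps_sums by (intro the1_equality[OF euler_number_ex1]) blast
  thus ?thesis by (rule fun_cong)
qed

end

theory Submission
  imports Defs "HOL-Number_Theory.Residues"
begin

text \<open>
  Sun's identity \<open>f\<^sub>n = (\<Sum>j. C(n+2j,3j) C(2j,j) C(3j,j) (-4)\<^sup>n\<^sup>-\<^sup>j)\<close> holds because both sides satisfy Franel's
  three-term recurrence, by creative telescoping. After inserting it and exchanging the summations,
  the sum over \<open>k\<close> telescopes by Gosper's algorithm, and with \<open>n = p = 2m + 1\<close> the left-hand side becomes
  \<open>p\<^sup>2 16\<^sup>-\<^sup>m C(2p-1,p-1)\<close> times the sum over \<open>j < p\<close> of \<open>d\<^sub>j / (2j + 1)\<close>, where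
  \<open>d\<^sub>j = C(p+2j,j) 4\<^sup>-\<^sup>j \<Prod>\<^sub>i\<^sub>\<le>\<^sub>j (1 - p\<^sup>2/i\<^sup>2)\<close>.

  Write \<open>H\<close> for the harmonic number with index \<open>m\<close> and \<open>A = (\<Sum>k\<le>m. (-1)\<^sup>k / k\<^sup>2)\<close>. Morley's congruence
  becomes \<open>4\<^sup>m = 1 - pH/2 + p\<^sup>2H\<^sup>2/8\<close> modulo \<open>p\<^sup>3\<close>. The terms with \<open>j < m\<close>, with \<open>j = m\<close> and with
  \<open>j > m\<close> are expanded separately around \<open>(-1)\<^sup>j C(m,j)\<close>; the reflection \<open>j \<mapsto> m - j\<close> turns their sums
  into classical alternating binomial sums with closed forms in \<open>H\<close> and \<open>A\<close>. The powers of \<open>H\<close> combine to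
  \<open>16\<^sup>m\<close>, and only \<open>(-1)\<^sup>m (p + p\<^sup>3 A / 2)\<close> remains. Finally \<open>E\<^sub>p\<^sub>-\<^sub>3 = (-1)\<^sup>m A / 2\<close> modulo \<open>p\<close>, by
  evaluating alternating sums of even powers through Euler polynomials and Fermat's theorem.
\<close>

section \<open>Franel numbers\<close>

lemma binomial_rat_Suc: "(of_nat n + 1 - of_nat k) * of_nat (Suc n choose k) = (of_nat n + 1) * (of_nat (n choose k) :: rat)"
proof (cases "k \<le> Suc n")
  case True
  have "(Suc n - k) * (Suc n choose k) = Suc n * (n choose k)"
    using binomial_absorb_comp[of "Suc n" k] by simp
  hence "of_nat (Suc n - k) * of_nat (Suc n choose k) = (of_nat (Suc n) * of_nat (n choose k) :: rat)"
    by (metis of_nat_mult)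
  with True show ?thesis by (simp add: of_nat_diff add.commute)
qed (simp add: binomial_eq_0)

lemma binomial_rat_Suc_right: "(of_nat k + 1) * of_nat (n choose Suc k) = (of_nat n - of_nat k) * (of_nat (n choose k) :: rat)"
proof (cases "k \<le> n")
  case True
  have "Suc k * (n choose Suc k) = (n - k) * (n choose k)"
    by (rule binomial_absorption[THEN trans]) (use True binomial_absorb_comp[of n k] in auto)
  hence "of_nat (Suc k) * of_nat (n choose Suc k) = (of_nat (n - k) * of_nat (n choose k) :: rat)"
    by (metis of_nat_mult)
  with True show ?thesis by (simp add: of_nat_diff add.commute)
qed (simp add: binomial_eq_0)

text \<open>Creative telescoping: the recurrence operator applied to \<open>(n choose k)^3\<close>
  equals \<open>G (Suc k) - G k\<close>, and \<open>G\<close> vanishes at \<open>0\<close> and at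
  \<open>n + 3\<close>. All three sums are padded with zeros to \<open>k < n + 3\<close>.\<close>

lemma franel_rec:
  "(of_nat n + 2)\<^sup>2 * of_nat (franel (n + 2)) =
     (7 * (of_nat n)\<^sup>2 + 21 * of_nat n + 16) * of_nat (franel (n + 1))
     + 8 * (of_nat n + 1)\<^sup>2 * (of_nat (franel n) :: rat)"
proof -
  define N :: rat where "N = of_nat n"
  have N: "N + 1 \<noteq> 0" "N + 2 \<noteq> 0"
    unfolding N_def using of_nat_0_le_iff[of n, where 'a=rat] by linarith+
  \<comment> \<open>\<open>G\<close> is the certificate of Zeilberger's algorithm for the cubes of binomial coefficients.\<close>
  define Q :: "rat \<Rightarrow> rat" where
    "Q k = 4 * k^3 - (18*N + 30) * k^2 + (27*N^2 + 93*N + 78) * k - (14*N^3 + 74*N^2 + 128*N + 72)" for k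
  define G :: "nat \<Rightarrow> rat" where
    "G k = Q (of_nat k) * (of_nat k * of_nat ((n+2) choose k))^3 / ((N+1) * (N+2)^3)" for k
  have aux: "q * ((N+2) * ((N+1) * x * y))^3 / ((N+1) * (N+2)^3) = q * (N+1)^2 * (x * y)^3" for q x y
  proof -
    have nz: "(N+1) * (N+2)^3 \<noteq> 0" using N by simp
    have "q * ((N+2) * ((N+1) * x * y))^3 = ((N+1) * (N+2)^3) * (q * (N+1)^2 * (x * y)^3)"
      by Groebner_Basis.algebra
    also have "\<dots> / ((N+1) * (N+2)^3) = q * (N+1)^2 * (x * y)^3"
      by (rule nonzero_mult_div_cancel_left[OF nz])
    finally show ?thesis .
  qed
  have sum_eq: "of_nat (franel r) = (\<Sum>k<n+3. (of_nat (r choose k))^3 :: rat)" if "r \<le> n + 2" for r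
  proof -
    have "of_nat (franel r) = (\<Sum>k\<in>{0..r}. (of_nat (r choose k))^3 :: rat)"
      by (simp add: franel_def)
    also have "\<dots> = (\<Sum>k<n+3. (of_nat (r choose k))^3 :: rat)"
      using that by (intro sum.mono_neutral_left) (auto simp: binomial_eq_0)
    finally show ?thesis .
  qed
  have e1: "of_nat (franel (n+1)) = (\<Sum>k<n+3. (of_nat ((n+1) choose k))^3 :: rat)"
    and e0: "of_nat (franel n) = (\<Sum>k<n+3. (of_nat (n choose k))^3 :: rat)"
    by (rule sum_eq, simp)+
  have step: "(N+2)^2 * (of_nat ((n+2) choose k))^3 - (7*N^2 + 21*N + 16) * (of_nat ((n+1) choose k))^3
      - 8 * (N+1)^2 * (of_nat (n choose k))^3 = G (Suc k) - G k" if "k < n + 3" for k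
  proof -
    define K :: rat where "K = of_nat k"
    \<comment> \<open>All three binomials are polynomial multiples of \<open>w\<close>. This avoids
      dividing by \<open>N + 1 - K\<close> or \<open>N + 2 - K\<close>, which vanish near the end of
      the range.\<close>
    define w :: rat where "w = of_nat ((n+2) choose k) / ((N+1) * (N+2))"
    have c2: "of_nat ((n+2) choose k) = (N+1) * (N+2) * w"
      using N by (simp add: w_def)
    have c1: "of_nat ((n+1) choose k) = (N+1) * (N + 2 - K) * w"
    proof -
      have "(N + 2 - K) * of_nat ((n+2) choose k) = (N+2) * (of_nat ((n+1) choose k) :: rat)"
        using binomial_rat_Suc[of "n+1" k] by (simp add: N_def K_def add_ac)
      hence "(N+2) * of_nat ((n+1) choose k) = (N+2) * ((N+1) * (N + 2 - K) * w)"
        unfolding c2 by (simp only: mult_ac)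
      thus ?thesis using N by simp
    qed
    have c0: "of_nat (n choose k) = (N+1-K) * (N+2-K) * w"
    proof -
      have "(N + 1 - K) * of_nat ((n+1) choose k) = (N+1) * (of_nat (n choose k) :: rat)"
        using binomial_rat_Suc[of n k] by (simp add: N_def K_def)
      hence "(N+1) * of_nat (n choose k) = (N+1) * ((N+1-K) * (N+2-K) * w)"
        unfolding c1 by (simp only: mult_ac)
      thus ?thesis using N by simp
    qed
    have "of_nat (Suc k) * of_nat ((n+2) choose (Suc k)) = (N+2) * (of_nat ((n+1) choose k) :: rat)"
      using Suc_times_binomial[of k "n+1"] unfolding N_def
      by (metis add_2_eq_Suc' of_nat_add of_nat_mult of_nat_numeral Suc_eq_plus1)
    hence "G (Suc k) = Q (K + 1) * ((N+2) * ((N+1) * (N + 2 - K) * w))^3 / ((N+1) * (N+2)^3)"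
      unfolding G_def c1 by (simp add: K_def add.commute)
    also have "\<dots> = Q (K + 1) * (N+1)^2 * ((N + 2 - K) * w)^3"
      using aux[of "Q (K + 1)" "N + 2 - K" w] by (simp only: mult_ac)
    finally have g1: "G (Suc k) = Q (K + 1) * (N+1)^2 * ((N + 2 - K) * w)^3" .
    have "G k = Q K * (N+1)^2 * (K * w)^3"
      unfolding G_def c2 K_def[symmetric]
      using aux[of "Q K" K w] by (simp only: mult_ac)
    hence g0: "G k = Q K * (N+1)^2 * (K * w)^3" .
    \<comment> \<open>The certificate equation after removal of the common factor
      \<open>(N+1)^2 * w^3\<close>: a polynomial identity in \<open>N\<close> and
      \<open>K\<close>.\<close>
    have core: "(N+2)^5 * (N+1) - (7*N^2 + 21*N + 16) * (N+1) * (N+2-K)^3 - 8 * ((N+1-K) * (N+2-K))^3 =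
        Q (K+1) * (N+2-K)^3 - Q K * K^3"
      unfolding Q_def by Groebner_Basis.algebra
    have "(N+2)^2 * ((N+1) * (N+2) * w)^3 - (7*N^2 + 21*N + 16) * ((N+1) * (N+2-K) * w)^3
        - 8 * (N+1)^2 * ((N+1-K) * (N+2-K) * w)^3
      = ((N+1)^2 * w^3) * ((N+2)^5 * (N+1) - (7*N^2 + 21*N + 16) * (N+1) * (N+2-K)^3 - 8 * ((N+1-K) * (N+2-K))^3)"
      by Groebner_Basis.algebra
    also have "\<dots> = Q (K+1) * (N+1)^2 * ((N+2-K) * w)^3 - Q K * (N+1)^2 * (K * w)^3"
      unfolding core by (subst right_diff_distrib) (simp only: power_mult_distrib mult_ac)
    finally show ?thesis unfolding g0 g1 c0 c1 c2 .
  qed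
  have "(N+2)^2 * of_nat (franel (n+2)) - (7*N^2 + 21*N + 16) * of_nat (franel (n+1))
      - 8 * (N+1)^2 * of_nat (franel n) = (\<Sum>k<n+3. G (Suc k) - G k)"
    unfolding sum_eq[OF order_refl] e1 e0
      sum_distrib_left sum_subtractf[symmetric]
    by (rule sum.cong) (use step in auto)
  also have "\<dots> = G (n+3) - G 0" by (rule sum_lessThan_telescope)
  also have "\<dots> = 0" by (simp add: G_def binomial_eq_0)
  finally show ?thesis unfolding N_def by (simp add: algebra_simps)
qed

section \<open>Sun's identity for the Franel numbers\<close>

definition trinom :: "nat \<Rightarrow> rat" where
  "trinom j = of_nat ((2*j) choose j) * of_nat ((3*j) choose j)"

lemma trinom_fact: "trinom j = fact (3*j) / fact j ^ 3"
proof -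
  have "of_nat ((2*j) choose j) = (fact (2*j) / (fact j * fact j) :: rat)"
    by (subst binomial_fact) auto
  moreover have "of_nat ((3*j) choose j) = (fact (3*j) / (fact j * fact (2*j)) :: rat)"
    by (subst binomial_fact) auto
  ultimately show ?thesis by (simp add: trinom_def power3_eq_cube)
qed

lemma trinom_Suc:
  "of_nat (Suc j) ^ 3 * trinom (Suc j) =
     (3 * of_nat j + 1) * (3 * of_nat j + 2) * (3 * of_nat j + 3) * trinom j"
proof -
  have "fact (3 * Suc j) = ((3 * of_nat j + 1) * (3 * of_nat j + 2) * (3 * of_nat j + 3) * fact (3*j) :: rat)"
    by (simp add: numeral_3_eq_3 algebra_simps)
  thus ?thesis
    unfolding trinom_fact by (simp add: power_mult_distrib)
qed

lemma binomial_rat_Suc_Suc: "(of_nat k + 1) * of_nat (Suc n choose Suc k) = (of_nat n + 1) * (of_nat (n choose k) :: rat)"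
proof -
  have "of_nat (Suc k) * of_nat (Suc n choose Suc k) = (of_nat (Suc n) * of_nat (n choose k) :: rat)"
    by (metis Suc_times_binomial of_nat_mult)
  thus ?thesis by (simp add: add.commute)
qed

text \<open>The quotient of powers replaces \<open>(-4)^(n-j)\<close>, so no truncated subtraction
  occurs; for \<open>j > n\<close> the binomial coefficient makes the term zero.\<close>

definition franel_summand :: "nat \<Rightarrow> nat \<Rightarrow> rat" where
  "franel_summand n j = of_nat ((n + 2*j) choose (3*j)) * trinom j * ((-4)^n / (-4)^j)"

text \<open>The hypergeometric ratio in \<open>n\<close>, kept free of denominators so that it also
  covers \<open>j = n + 1\<close>.\<close>

lemma franel_summand_Suc_left: "(of_nat n + 1 - of_nat j) * franel_summand (Suc n) j = -4 * (of_nat n + 1 + 2 * of_nat j) * franel_summand n j"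
proof -
  have "(of_nat n + 1 - of_nat j) * of_nat ((Suc n + 2*j) choose (3*j)) =
      (of_nat n + 1 + 2 * of_nat j) * (of_nat ((n + 2*j) choose (3*j)) :: rat)"
    using binomial_rat_Suc[of "n+2*j" "3*j"] by (simp add: algebra_simps)
  hence "(of_nat n + 1 - of_nat j) * of_nat ((Suc n + 2*j) choose (3*j)) * (trinom j * (-4 * ((-4)^n / (-4)^j))) =
      (of_nat n + 1 + 2 * of_nat j) * of_nat ((n + 2*j) choose (3*j)) * (trinom j * (-4 * ((-4)^n / (-4)^j)))"
    by (rule arg_cong)
  thus ?thesis unfolding franel_summand_def by (simp only: power_Suc times_divide_eq_right mult_ac)
qed

text \<open>The binomial coefficient moves in three steps: the lower index is raised once, then both
  indices twice. The linear factors \<open>3*j+1\<close>, \<open>3*j+2\<close>, \<open>3*j+3\<close>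
  so produced cancel against those of \<open>trinom_Suc\<close>.\<close>

lemma franel_summand_Suc_right:
  "-4 * (of_nat j + 1)^3 * franel_summand n (Suc j) =
     (of_nat n + 2 * of_nat j + 1) * (of_nat n + 2 * of_nat j + 2) * (of_nat n - of_nat j) * franel_summand n j"
proof -
  define J N :: rat where "J = of_nat j" and "N = of_nat n"
  define x0 x1 x2 x3 :: rat where "x0 = of_nat ((n + 2*j) choose (3*j))"
    and "x1 = of_nat ((n + 2*j) choose Suc (3*j))"
    and "x2 = of_nat (Suc (n + 2*j) choose Suc (Suc (3*j)))"
    and "x3 = of_nat (Suc (Suc (n + 2*j)) choose Suc (Suc (Suc (3*j))))"
  have 1: "(3*J+1) * x1 = (N - J) * x0"
    using binomial_rat_Suc_right[of "3*j" "n+2*j"] by (simp add: x0_def x1_def J_def N_def)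
  have 2: "(3*J+2) * x2 = (N + 2*J + 1) * x1"
    using binomial_rat_Suc_Suc[of "Suc (3*j)" "n+2*j"] by (simp add: x2_def x1_def J_def N_def add_ac)
  have 3: "(3*J+3) * x3 = (N + 2*J + 2) * x2"
    using binomial_rat_Suc_Suc[of "Suc (Suc (3*j))" "Suc (n+2*j)"] by (simp add: x2_def x3_def J_def N_def add_ac)
  have 4: "(J+1)^3 * trinom (Suc j) = (3*J+1) * (3*J+2) * (3*J+3) * trinom j"
    using trinom_Suc[of j] by (simp add: J_def add_ac)
  have x3: "x3 = of_nat ((n + 2 * Suc j) choose (3 * Suc j))"
    by (simp add: x3_def numeral_3_eq_3)
  have "-4 * (J+1)^3 * franel_summand n (Suc j) = x3 * ((J+1)^3 * trinom (Suc j)) * ((-4)^n / (-4)^j)"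
    unfolding franel_summand_def x3[symmetric] by simp
  also have "\<dots> = (N + 2*J + 1) * (N + 2*J + 2) * (N - J) * (x0 * trinom j * ((-4)^n / (-4)^j))"
  proof -
    have "x3 * ((J+1)^3 * trinom (Suc j)) = (3*J+1) * ((3*J+2) * ((3*J+3) * x3)) * trinom j"
      unfolding 4 by (simp only: mult_ac)
    also have "\<dots> = (N + 2*J + 2) * (N + 2*J + 1) * ((3*J+1) * x1) * trinom j"
      unfolding 3 mult.left_commute[of "3*J+2"] 2 by (simp only: mult_ac)
    also have "\<dots> = (N + 2*J + 2) * (N + 2*J + 1) * ((N - J) * x0) * trinom j"
      unfolding 1 ..
    finally show ?thesis by (simp only: mult_ac)
  qed
  finally show ?thesis by (simp add: franel_summand_def J_def N_def x0_def add_ac)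
qed

lemma franel_summand_eq_0: "n < j \<Longrightarrow> franel_summand n j = 0"
  by (simp add: franel_summand_def binomial_eq_0)

lemma sum_franel_summand_rec:
  "(of_nat n + 2)\<^sup>2 * (\<Sum>j\<le>n+2. franel_summand (n+2) j) =
     (7 * (of_nat n)\<^sup>2 + 21 * of_nat n + 16) * (\<Sum>j\<le>n+1. franel_summand (n+1) j)
     + 8 * (of_nat n + 1)\<^sup>2 * (\<Sum>j\<le>n. franel_summand n j)"
proof -
  define N :: rat where "N = of_nat n"
  have N: "N \<ge> 0" by (simp add: N_def)
  define w :: "nat \<Rightarrow> rat" where
    "w j = franel_summand (n+2) j / (16 * (N + 2 + 2 * of_nat j) * (N + 1 + 2 * of_nat j))" for j
  \<comment> \<open>Zeilberger's algorithm again; \<open>w\<close> is the common factor of the three shifted summands.\<close>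
  define G :: "nat \<Rightarrow> rat" where "G j = -48 * (3*N+5) * of_nat j ^ 3 * w j" for j
  have ext: "(\<Sum>j\<le>r. franel_summand r j) = (\<Sum>j<n+3. franel_summand r j)" if "r \<le> n + 2" for r
    using that by (intro sum.mono_neutral_left) (auto simp: franel_summand_eq_0)
  have e1: "(\<Sum>j\<le>n+1. franel_summand (n+1) j) = (\<Sum>j<n+3. franel_summand (n+1) j)"
    and e0: "(\<Sum>j\<le>n. franel_summand n j) = (\<Sum>j<n+3. franel_summand n j)"
    by (rule ext, simp)+
  have step: "(N+2)^2 * franel_summand (n+2) j - (7*N^2 + 21*N + 16) * franel_summand (n+1) j
      - 8 * (N+1)^2 * franel_summand n j = G (Suc j) - G j" for j
  proof -
    define J :: rat where "J = of_nat j"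
    have J: "J \<ge> 0" by (simp add: J_def)
    have nz: "N + 2 + 2*J \<noteq> 0" "N + 1 + 2*J \<noteq> 0" "N + 4 + 2*J \<noteq> 0" "N + 3 + 2*J \<noteq> 0" "J + 1 \<noteq> 0" using J N by linarith+
    have c2: "franel_summand (n+2) j = 16 * (N + 2 + 2*J) * (N + 1 + 2*J) * w j"
      using nz by (simp add: w_def J_def)
    have c1: "franel_summand (n+1) j = -4 * (N + 1 + 2*J) * (N + 2 - J) * w j"
    proof -
      have "(N + 2 - J) * franel_summand (n+2) j = -4 * (N + 2 + 2*J) * franel_summand (n+1) j"
        using franel_summand_Suc_left[of "n+1" j] by (simp add: N_def J_def add_ac)
      hence "(N + 2 + 2*J) * franel_summand (n+1) j = (N + 2 + 2*J) * (-4 * (N + 1 + 2*J) * (N + 2 - J) * w j)"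
        unfolding c2 by Groebner_Basis.algebra
      thus ?thesis using nz by simp
    qed
    have c0: "franel_summand n j = (N + 2 - J) * (N + 1 - J) * w j"
    proof -
      have "(N + 1 - J) * franel_summand (n+1) j = -4 * (N + 1 + 2*J) * franel_summand n j"
        using franel_summand_Suc_left[of n j] by (simp add: N_def J_def add_ac)
      hence "(N + 1 + 2*J) * franel_summand n j = (N + 1 + 2*J) * ((N + 2 - J) * (N + 1 - J) * w j)"
        unfolding c1 by Groebner_Basis.algebra
      thus ?thesis using nz by simp
    qed
    have "w (Suc j) = franel_summand (n+2) (Suc j) / (16 * (N + 4 + 2*J) * (N + 3 + 2*J))"
      unfolding w_def J_def of_nat_Suc by (simp add: algebra_simps)
    hence "16 * (N + 4 + 2*J) * (N + 3 + 2*J) * w (Suc j) = franel_summand (n+2) (Suc j)"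
      using nz by simp
    moreover have "-4 * (J+1)^3 * franel_summand (n+2) (Suc j) =
        (N + 3 + 2*J) * (N + 4 + 2*J) * (N + 2 - J) * franel_summand (n+2) j"
      using franel_summand_Suc_right[of j "n+2"] by (simp add: N_def J_def add_ac)
    ultimately have "-4 * (J+1)^3 * (16 * (N + 4 + 2*J) * (N + 3 + 2*J) * w (Suc j)) =
        (N + 3 + 2*J) * (N + 4 + 2*J) * (N + 2 - J) * (16 * (N + 2 + 2*J) * (N + 1 + 2*J) * w j)"
      unfolding c2 by (simp only:)
    hence "(16 * (N + 4 + 2*J) * (N + 3 + 2*J)) * (-4 * (J+1)^3 * w (Suc j)) =
        (16 * (N + 4 + 2*J) * (N + 3 + 2*J)) * ((N + 2 - J) * (N + 2 + 2*J) * (N + 1 + 2*J) * w j)"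
      by (simp only: mult_ac)
    hence "-4 * (J+1)^3 * w (Suc j) = (N + 2 - J) * (N + 2 + 2*J) * (N + 1 + 2*J) * w j"
      using nz by (simp only: mult_cancel_left) simp
    moreover have "G (Suc j) = -48 * (3*N+5) * (J+1)^3 * w (Suc j)"
      by (simp add: G_def J_def add_ac)
    ultimately have "G (Suc j) = 12 * (3*N+5) * ((N + 2 - J) * (N + 2 + 2*J) * (N + 1 + 2*J) * w j)"
      by Groebner_Basis.algebra
    moreover have "G j = -48 * (3*N+5) * J^3 * w j" by (simp add: G_def J_def)
    ultimately show ?thesis unfolding c0 c1 c2 by Groebner_Basis.algebra
  qed
  have "(N+2)^2 * (\<Sum>j\<le>n+2. franel_summand (n+2) j) - (7*N^2 + 21*N + 16) * (\<Sum>j\<le>n+1. franel_summand (n+1) j)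
      - 8 * (N+1)^2 * (\<Sum>j\<le>n. franel_summand n j) = (\<Sum>j<n+3. G (Suc j) - G j)"
    unfolding ext[OF order_refl] e1 e0
      sum_distrib_left sum_subtractf[symmetric]
    by (rule sum.cong) (use step in auto)
  also have "\<dots> = G (n+3) - G 0" by (rule sum_lessThan_telescope)
  also have "\<dots> = 0" by (simp add: G_def w_def franel_summand_eq_0)
  finally show ?thesis unfolding N_def by (simp add: algebra_simps)
qed

text \<open>Both sides satisfy the same second-order recurrence, whose leading coefficient
  \<open>(n+2)^2\<close> never vanishes, and they agree at \<open>0\<close> and
  \<open>1\<close>.\<close>

lemma franel_eq_sum_franel_summand: "of_nat (franel n) = (\<Sum>j\<le>n. franel_summand n j)"
proof (induction n rule: induct_nat_012)
  case 0
  show ?case by (simp add: franel_def franel_summand_def trinom_def)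
next
  case 1
  show ?case by (simp add: franel_def franel_summand_def trinom_def numeral_3_eq_3)
next
  case (ge2 n)
  have "(of_nat n + 2)\<^sup>2 * (of_nat (franel (n+2)) :: rat) = (of_nat n + 2)\<^sup>2 * (\<Sum>j\<le>n+2. franel_summand (n+2) j)"
    unfolding franel_rec sum_franel_summand_rec using ge2 by simp
  moreover have "(of_nat n + 2 :: rat)\<^sup>2 \<noteq> 0"
    using of_nat_0_le_iff[of n, where 'a=rat] by (simp add: add_nonneg_eq_0_iff)
  ultimately show ?case by simp
qed

section \<open>Gosper summation over k\<close>

lemma central_binomial_rat_Suc:
  "(of_nat n + 1) * of_nat ((2 * Suc n) choose (Suc n)) = 2 * (2 * of_nat n + 1) * (of_nat ((2*n) choose n) :: rat)"
proof -
  have "(of_nat n + 1) * of_nat (Suc (2*n) choose n) = (2 * of_nat n + 1) * (of_nat ((2*n) choose n) :: rat)"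
    using binomial_rat_Suc[of "2*n" n] by (simp add: algebra_simps)
  moreover have "(of_nat n + 1) * of_nat (Suc (Suc (2*n)) choose Suc n) = 2 * (of_nat n + 1) * (of_nat (Suc (2*n) choose n) :: rat)"
    using binomial_rat_Suc_Suc[of n "Suc (2*n)"] by (simp add: algebra_simps)
  moreover have "2 * Suc n = Suc (Suc (2*n))" by simp
  ultimately show ?thesis by (simp only:)
qed

text \<open>The right-hand side is an antidifference found by Gosper's algorithm: it vanishes at
  \<open>n = 0\<close>, and its increment is the summand.\<close>

lemma sum_binomial_gosper:
  "(\<Sum>k<n. (3 * of_nat k + 1) * of_nat ((2*k) choose k) / 4^k * of_nat ((k + 2*j) choose (3*j))) =
     2 * of_nat n * (of_nat n - of_nat j) * of_nat ((2*n) choose n) / 4^n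
       * of_nat ((n + 2*j) choose (3*j)) / (2 * of_nat j + 1 :: rat)"
proof (induction n)
  case (Suc n)
  define N J :: rat where "N = of_nat n" and "J = of_nat j"
  define c x :: rat where "c = of_nat ((2*n) choose n) / 4^n" and "x = of_nat ((n + 2*j) choose (3*j))"
  have nz: "N + 1 \<noteq> 0" "2*J + 1 \<noteq> 0"
    unfolding N_def J_def using of_nat_0_le_iff[of n, where 'a=rat] of_nat_0_le_iff[of j, where 'a=rat] by linarith+
  have x: "(N + 1 - J) * of_nat ((Suc n + 2*j) choose (3*j)) = (N + 1 + 2*J) * x"
    using binomial_rat_Suc[of "n+2*j" "3*j"] by (simp add: x_def N_def J_def algebra_simps)
  have c: "2 * (N+1) * (of_nat ((2 * Suc n) choose (Suc n)) / 4 ^ Suc n) = (2*N+1) * c"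
  proof -
    have rel: "(N+1) * of_nat ((2 * Suc n) choose (Suc n)) = 2 * (2*N+1) * of_nat ((2*n) choose n)"
      using central_binomial_rat_Suc[of n] unfolding N_def .
    have cancel: "2 * M * (b / (4 * t)) = r * (a / t)" if "M * b = 2 * r * a" "t \<noteq> 0" for M b r a t :: rat
      using that by (simp add: field_simps)
    show ?thesis unfolding c_def power_Suc by (rule cancel[OF rel]) simp
  qed
  have "2 * of_nat (Suc n) * (of_nat (Suc n) - of_nat j) * of_nat ((2*Suc n) choose Suc n) / 4^Suc n
       * of_nat ((Suc n + 2*j) choose (3*j)) / (2 * of_nat j + 1 :: rat)
     = (2 * (N+1) * (of_nat ((2 * Suc n) choose (Suc n)) / 4 ^ Suc n)) *
       ((N + 1 - J) * of_nat ((Suc n + 2*j) choose (3*j))) / (2*J+1)"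
    by (simp add: N_def J_def add_ac)
  also have "\<dots> = (2*N+1) * c * ((N + 1 + 2*J) * x) / (2*J+1)"
    unfolding x c ..
  \<comment> \<open>This rests on
    \<open>(2*N+1) * (N+1+2*J) = 2*N*(N-J) + (3*N+1) * (2*J+1)\<close>.\<close>
  also have "\<dots> = 2 * N * (N - J) * c * x / (2*J+1) + (3*N+1) * c * x"
    using nz by (simp add: field_simps)
  finally show ?case
    using Suc.IH by (simp add: N_def J_def c_def x_def)
qed simp

lemma sum_franel_eq:
  "(\<Sum>k<n. of_nat ((2 * k) choose k) * (of_nat (3 * k + 1) / (-16) ^ k) * of_nat (franel k)) =
     2 * of_nat n * of_nat ((2*n) choose n) / 4^n *
     (\<Sum>j<n. (of_nat n - of_nat j) * (of_nat ((n + 2*j) choose (3*j)) * trinom j / (-4)^j) / (2 * of_nat j + 1 :: rat))"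
proof -
  have "(\<Sum>k<n. of_nat ((2 * k) choose k) * (of_nat (3 * k + 1) / (-16) ^ k) * of_nat (franel k)) =
      (\<Sum>k<n. \<Sum>j<n. ((3 * of_nat k + 1) * of_nat ((2*k) choose k) / 4^k * of_nat ((k + 2*j) choose (3*j))) *
        (trinom j / (-4)^j))"
  proof (rule sum.cong[OF refl])
    fix k assume "k \<in> {..<n}"
    hence f: "of_nat (franel k) = (\<Sum>j<n. franel_summand k j)"
      unfolding franel_eq_sum_franel_summand by (intro sum.mono_neutral_left) (auto simp: franel_summand_eq_0)
    \<comment> \<open>The factor \<open>(-4)^k\<close> cancels the one in
      \<open>franel_summand k j\<close>; the factor \<open>4^k\<close> stays with the central
      binomial coefficient, as \<open>sum_binomial_gosper\<close> requires.\<close>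
    have "((-16) ^ k :: rat) = (-4)^k * 4^k" by (simp flip: power_mult_distrib)
    thus "of_nat ((2 * k) choose k) * (of_nat (3 * k + 1) / (-16) ^ k) * of_nat (franel k) =
      (\<Sum>j<n. ((3 * of_nat k + 1) * of_nat ((2*k) choose k) / 4^k * of_nat ((k + 2*j) choose (3*j))) *
        (trinom j / (-4)^j))"
      unfolding f sum_distrib_left by (intro sum.cong) (simp_all add: franel_summand_def mult_ac)
  qed
  also have "\<dots> = (\<Sum>j<n. (\<Sum>k<n. (3 * of_nat k + 1) * of_nat ((2*k) choose k) / 4^k * of_nat ((k + 2*j) choose (3*j))) *
        (trinom j / (-4)^j))"
    unfolding sum_distrib_right by (rule sum.swap)
  also have "\<dots> = 2 * of_nat n * of_nat ((2*n) choose n) / 4^n *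
     (\<Sum>j<n. (of_nat n - of_nat j) * (of_nat ((n + 2*j) choose (3*j)) * trinom j / (-4)^j) / (2 * of_nat j + 1 :: rat))"
    unfolding sum_binomial_gosper sum_distrib_left by (intro sum.cong) (simp_all add: mult_ac)
  finally show ?thesis .
qed

section \<open>The remaining single sum over j\<close>

text \<open>The \<open>d_j\<close> of the introduction. For \<open>n = p\<close> and
  \<open>j < p\<close>, every factor of the product is 1 modulo \<open>p^2\<close>, which makes the
  shape suitable for p-adic expansion.\<close>

definition reduced_summand :: "nat \<Rightarrow> nat \<Rightarrow> rat" where
  "reduced_summand n j = of_nat ((n + 2*j) choose j) / 4^j * (\<Prod>i=1..j. 1 - (of_nat n)\<^sup>2 / (of_nat i)\<^sup>2)"

lemma reduced_summand_0 [simp]: "reduced_summand n 0 = 1"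
  by (simp add: reduced_summand_def)

lemma reduced_summand_Suc:
  "reduced_summand n (Suc j) = reduced_summand n j * ((of_nat n + 2 * of_nat j + 2) * (of_nat n + 2 * of_nat j + 1) /
      (4 * (of_nat j + 1) * (of_nat n + of_nat j + 1))) * (1 - (of_nat n)\<^sup>2 / (of_nat (Suc j))\<^sup>2)"
proof -
  define N J :: rat where "N = of_nat n" and "J = of_nat j"
  have nz: "J + 1 \<noteq> 0" "N + J + 1 \<noteq> 0"
    unfolding N_def J_def using of_nat_0_le_iff[of n, where 'a=rat] of_nat_0_le_iff[of j, where 'a=rat] by linarith+
  define x0 x1 x2 :: rat where "x0 = of_nat ((n + 2*j) choose j)"
    and "x1 = of_nat (Suc (n + 2*j) choose j)" and "x2 = of_nat (Suc (Suc (n + 2*j)) choose Suc j)"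
  have 1: "(N + J + 1) * x1 = (N + 2*J + 1) * x0"
    using binomial_rat_Suc[of "n+2*j" j] by (simp add: x0_def x1_def J_def N_def add_ac)
  have 2: "(J + 1) * x2 = (N + 2*J + 2) * x1"
    using binomial_rat_Suc_Suc[of j "Suc (n+2*j)"] by (simp add: x2_def x1_def J_def N_def add_ac)
  have "x2 = (N + 2*J + 2) * (N + 2*J + 1) / ((J+1) * (N+J+1)) * x0"
  proof -
    have "x1 = (N + 2*J + 1) * x0 / (N + J + 1)" using 1 nz by (simp add: eq_divide_eq mult.commute)
    moreover have "x2 = (N + 2*J + 2) * x1 / (J + 1)" using 2 nz by (simp add: eq_divide_eq mult.commute)
    ultimately show ?thesis by (simp add: mult_ac)
  qed
  moreover have "x2 = of_nat ((n + 2 * Suc j) choose Suc j)" unfolding x2_def by simp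
  ultimately have rel: "of_nat ((n + 2 * Suc j) choose Suc j) = (N + 2*J + 2) * (N + 2*J + 1) / ((J+1) * (N+J+1)) * x0"
    by (simp only:)
  have prod: "(\<Prod>i=1..Suc j. 1 - (of_nat n)\<^sup>2 / (of_nat i)\<^sup>2 :: rat) =
      (\<Prod>i=1..j. 1 - (of_nat n)\<^sup>2 / (of_nat i)\<^sup>2) * (1 - (of_nat n)\<^sup>2 / (of_nat (Suc j))\<^sup>2)"
    by simp
  have "(A / (d * s) * x) / (4 * f) * (P * z) = x / f * P * (A / (4 * d * s)) * z" for A d s x f P z :: rat
    by (simp add: mult_ac)
  thus ?thesis
    unfolding reduced_summand_def rel power_Suc prod
    unfolding N_def J_def x0_def .
qed

text \<open>Both sides agree at \<open>j = 0\<close> and have the same ratio. The factor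
  \<open>n - j\<close> supplies \<open>n - (j+1)\<close> in the numerator, which is a factor of
  \<open>1 - n^2/(j+1)^2\<close>.\<close>

lemma trinom_eq_reduced_summand:
  "(of_nat n - of_nat j) * (of_nat ((n + 2*j) choose (3*j)) * trinom j / (-4)^j) = of_nat n * reduced_summand n j"
proof (induction j)
  case 0
  show ?case by (simp add: trinom_def)
next
  case (Suc j)
  define N J :: rat where "N = of_nat n" and "J = of_nat j"
  have nz: "J + 1 \<noteq> 0" "N + J + 1 \<noteq> 0"
    unfolding N_def J_def using of_nat_0_le_iff[of n, where 'a=rat] of_nat_0_le_iff[of j, where 'a=rat] by linarith+
  define u where "u j = of_nat ((n + 2*j) choose (3*j)) * trinom j / (-4)^j" for j
  have u: "franel_summand n j = (-4)^n * u j" for j by (simp add: franel_summand_def u_def)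
  have "(-4)^n * (-4 * (J + 1)^3 * u (Suc j)) = (-4)^n * ((N + 2*J + 1) * (N + 2*J + 2) * ((N - J) * u j))"
    using franel_summand_Suc_right[of j n] unfolding u J_def N_def by (simp only: mult_ac)
  hence "-4 * (J + 1)^3 * u (Suc j) = (N + 2*J + 1) * (N + 2*J + 2) * ((N - J) * u j)"
    by (simp only: mult_cancel_left) simp
  moreover have "-4 * (J+1)^3 \<noteq> 0" using nz by simp
  ultimately have "u (Suc j) = (N + 2*J + 1) * (N + 2*J + 2) * ((N - J) * u j) / (-4 * (J+1)^3)"
    by (metis nonzero_mult_div_cancel_left)
  moreover have "(N - J) * u j = N * reduced_summand n j"
    using Suc.IH by (simp add: N_def J_def u_def)
  ultimately have "(N - (J + 1)) * u (Suc j) = N * ((N - (J + 1)) * ((N + 2*J + 1) * (N + 2*J + 2) * reduced_summand n j) / (-4 * (J+1)^3))"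
    by simp
  also have "\<dots> = N * (reduced_summand n j * ((N + 2*J + 2) * (N + 2*J + 1) / (4 * (J + 1) * (N + J + 1))) * (1 - N\<^sup>2 / (J + 1)\<^sup>2))"
  proof -
    have fac: "1 - N\<^sup>2 / (J + 1)\<^sup>2 = - (N - (J + 1)) * (N + J + 1) / (J + 1)\<^sup>2"
      using nz by (simp add: field_simps) Groebner_Basis.algebra
    have cancel: "N * (e * (a * b * D) / (-4 * d^3)) = N * (D * (b * a / (4 * d * s)) * (- e * s / d\<^sup>2))"
      if "d \<noteq> 0" "s \<noteq> 0" for a b d s e D :: rat
      using that by (simp add: power2_eq_square power3_eq_cube mult_ac)
    show ?thesis unfolding fac by (rule cancel[OF nz])
  qed
  also have "\<dots> = N * reduced_summand n (Suc j)"
    by (simp add: reduced_summand_Suc N_def J_def add_ac)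
  finally show ?case by (simp add: N_def J_def u_def add_ac)
qed

lemma sum_franel_eq_reduced_summand:
  "(\<Sum>k<n. of_nat ((2 * k) choose k) * (of_nat (3 * k + 1) / (-16) ^ k) * of_nat (franel k)) =
     2 * (of_nat n)\<^sup>2 * of_nat ((2*n) choose n) / 4^n * (\<Sum>j<n. reduced_summand n j / (2 * of_nat j + 1 :: rat))"
  unfolding sum_franel_eq trinom_eq_reduced_summand
  by (simp add: power2_eq_square sum_distrib_left mult_ac)

section \<open>Alternating binomial sums\<close>

definition alt_binom :: "nat \<Rightarrow> nat \<Rightarrow> rat" where
  "alt_binom n j = (-1)^j * of_nat (n choose j)"

definition hsum :: "nat \<Rightarrow> rat" where
  "hsum n = (\<Sum>i<n. 1 / (of_nat i + 1))"

definition hsum2 :: "nat \<Rightarrow> rat" where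
  "hsum2 n = (\<Sum>i<n. 1 / (of_nat i + 1)^2)"

definition osum :: "nat \<Rightarrow> rat" where
  "osum n = (\<Sum>i<n. 1 / (2 * of_nat i + 1))"

lemma hsum_simps [simp]: "hsum 0 = 0" "hsum (Suc n) = hsum n + 1 / (of_nat n + 1)"
  by (simp_all add: hsum_def)

lemma hsum2_simps [simp]: "hsum2 0 = 0" "hsum2 (Suc n) = hsum2 n + 1 / (of_nat n + 1)^2"
  by (simp_all add: hsum2_def)

lemma osum_simps [simp]: "osum 0 = 0" "osum (Suc n) = osum n + 1 / (2 * of_nat n + 1)"
  by (simp_all add: osum_def)

lemma of_nat_plus_one_nonzero [simp]: "(of_nat n + 1 :: rat) \<noteq> 0" "(2 * of_nat n + 1 :: rat) \<noteq> 0"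
  using of_nat_0_le_iff[of n, where 'a=rat] by linarith+

lemma alt_binom_0 [simp]: "alt_binom n 0 = 1"
  by (simp add: alt_binom_def)

lemma alt_binom_eq_0: "n < j \<Longrightarrow> alt_binom n j = 0"
  by (simp add: alt_binom_def binomial_eq_0)

lemma alt_binom_nonzero: "j \<le> n \<Longrightarrow> alt_binom n j \<noteq> 0"
  by (simp add: alt_binom_def)

lemma alt_binom_self: "alt_binom n n = (-1)^n"
  by (simp add: alt_binom_def)

lemma alt_binom_Suc_Suc: "alt_binom (Suc n) (Suc j) = alt_binom n (Suc j) - alt_binom n j"
  by (simp add: alt_binom_def algebra_simps)

lemma alt_binom_Suc_right: "(of_nat j + 1) * alt_binom n (Suc j) = - (of_nat n - of_nat j) * alt_binom n j"
proof -
  have "(of_nat j + 1) * alt_binom n (Suc j) = - ((-1)^j * ((of_nat j + 1) * of_nat (n choose Suc j)))"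
    by (simp add: alt_binom_def)
  also have "\<dots> = - (of_nat n - of_nat j) * alt_binom n j"
    unfolding binomial_rat_Suc_right by (simp add: alt_binom_def algebra_simps)
  finally show ?thesis .
qed

lemma alt_binom_absorb: "(of_nat j + 1) * alt_binom (Suc n) (Suc j) = - (of_nat n + 1) * alt_binom n j"
proof -
  have "(of_nat j + 1) * alt_binom (Suc n) (Suc j) = - ((-1)^j * ((of_nat j + 1) * of_nat (Suc n choose Suc j)))"
    by (simp add: alt_binom_def del: binomial_Suc_Suc)
  also have "\<dots> = - (of_nat n + 1) * alt_binom n j"
    unfolding binomial_rat_Suc_Suc by (simp add: alt_binom_def algebra_simps)
  finally show ?thesis .
qed

lemma alt_binom_Suc_left: "(of_nat n + 1 - of_nat j) * alt_binom (Suc n) j = (of_nat n + 1) * alt_binom n j"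
  using binomial_rat_Suc[of n j] by (simp add: alt_binom_def mult.left_commute)

lemma alt_binom_div_Suc: "alt_binom n j / (of_nat j + 1) = - alt_binom (Suc n) (Suc j) / (of_nat n + 1)"
  using alt_binom_absorb[of j n] by (simp add: field_simps)

lemma alt_binom_reflect: "j \<le> n \<Longrightarrow> alt_binom n (n - j) = (-1)^n * alt_binom n j"
proof -
  assume j: "j \<le> n"
  have "(-1)^n = ((-1)^(n-j) * (-1)^j :: rat)" using j by (simp flip: power_add)
  thus ?thesis using j by (simp add: alt_binom_def binomial_symmetric[of j n])
qed

text \<open>Pascal's rule read as summation by parts: raising \<open>n\<close> replaces
  \<open>y\<close> by minus its forward difference.\<close>

lemma alt_binom_sum_Suc:
  "(\<Sum>j\<le>Suc n. alt_binom (Suc n) j * y j) = - (\<Sum>j\<le>n. alt_binom n j * (y (Suc j) - y j))"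
proof -
  have "(\<Sum>j\<le>Suc n. alt_binom (Suc n) j * y j) = y 0 + (\<Sum>j\<le>n. alt_binom n (Suc j) * y (Suc j)) - (\<Sum>j\<le>n. alt_binom n j * y (Suc j))"
    by (subst sum.atMost_Suc_shift) (simp add: alt_binom_Suc_Suc left_diff_distrib sum_subtractf)
  also have "y 0 + (\<Sum>j\<le>n. alt_binom n (Suc j) * y (Suc j)) = (\<Sum>j\<le>Suc n. alt_binom n j * y j)"
    by (subst sum.atMost_Suc_shift) simp
  also have "\<dots> = (\<Sum>j\<le>n. alt_binom n j * y j)" by (simp add: alt_binom_eq_0)
  finally show ?thesis by (simp add: right_diff_distrib sum_subtractf)
qed

lemma alt_binom_sum_shift:
  "(\<Sum>j<n. alt_binom n (Suc j) * y (Suc j)) = (\<Sum>j\<le>n. alt_binom n j * y j) - y 0"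
  by (simp add: lessThan_Suc_atMost[symmetric] sum.lessThan_Suc_shift del: sum.lessThan_Suc)

text \<open>Pascal's rule splits off \<open>alt_binom n j / (j+1)\<close>, and absorption turns this
  into a multiple of \<open>alt_binom (Suc n) (Suc j)\<close> with denominator \<open>n + 1\<close>.
  Induction on \<open>n\<close> thus trades the weight \<open>1/(j+1)\<close> for the unweighted
  sum.\<close>

lemma alt_binom_sum_div_Suc:
  "(\<Sum>j<Suc n. alt_binom (Suc n) (Suc j) * x j / (of_nat j + 1)) =
     (\<Sum>j<n. alt_binom n (Suc j) * x j / (of_nat j + 1))
     + (\<Sum>j<Suc n. alt_binom (Suc n) (Suc j) * x j) / (of_nat n + 1)"
proof -
  have "alt_binom (Suc n) (Suc j) * x j / (of_nat j + 1) =
      alt_binom n (Suc j) * x j / (of_nat j + 1) + alt_binom (Suc n) (Suc j) * x j / (of_nat n + 1)" for j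
  proof -
    have "alt_binom (Suc n) (Suc j) * x j / (of_nat j + 1) =
        alt_binom n (Suc j) * x j / (of_nat j + 1) - (alt_binom n j / (of_nat j + 1)) * x j"
      by (simp add: alt_binom_Suc_Suc diff_divide_distrib left_diff_distrib)
    thus ?thesis by (simp add: alt_binom_div_Suc)
  qed
  hence "(\<Sum>j<Suc n. alt_binom (Suc n) (Suc j) * x j / (of_nat j + 1)) =
      (\<Sum>j<Suc n. alt_binom n (Suc j) * x j / (of_nat j + 1)) +
      (\<Sum>j<Suc n. alt_binom (Suc n) (Suc j) * x j) / (of_nat n + 1)"
    by (simp only: sum.distrib sum_divide_distrib)
  thus ?thesis by (simp add: alt_binom_eq_0)
qed

lemma sum_alt_binom: "(\<Sum>j\<le>Suc n. alt_binom (Suc n) j) = 0"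
  using alt_binom_sum_Suc[of n "\<lambda>_. 1"] by simp

lemma sum_alt_binom_div: "(\<Sum>j<n. alt_binom n (Suc j) / (of_nat j + 1)) = - hsum n"
proof (induction n)
  case (Suc n)
  show ?case
    using alt_binom_sum_div_Suc[of n "\<lambda>_. 1"] alt_binom_sum_shift[of "Suc n" "\<lambda>_. 1"] sum_alt_binom[of n] Suc
    by (simp del: sum.lessThan_Suc sum.atMost_Suc)
qed simp

lemma sum_alt_binom_div_square:
  "(\<Sum>j<n. alt_binom n (Suc j) / (of_nat j + 1)^2) = - ((hsum n)^2 + hsum2 n) / 2"
proof (induction n)
  case (Suc n)
  have e: "alt_binom k (Suc j) * (1 / (of_nat j + 1)) / (of_nat j + 1) = alt_binom k (Suc j) / (of_nat j + 1)^2" for j k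
    by (simp add: power2_eq_square)
  have "(\<Sum>j<Suc n. alt_binom (Suc n) (Suc j) / (of_nat j + 1)^2) =
      - ((hsum n)^2 + hsum2 n) / 2 - hsum (Suc n) / (of_nat n + 1)"
    using alt_binom_sum_div_Suc[of n "\<lambda>j. 1 / (of_nat j + 1)"] sum_alt_binom_div[of "Suc n"] Suc
    unfolding e by (simp add: sum_divide_distrib[symmetric] del: sum.lessThan_Suc hsum_simps)
  also have "\<dots> = - ((hsum (Suc n))^2 + hsum2 (Suc n)) / 2"
  proof -
    have "- (h^2 + h2) / 2 - (h + r) * r = - ((h + r)^2 + (h2 + r^2)) / 2" for h h2 r :: rat
      by (simp add: power2_eq_square field_simps)
    from this[of "hsum n" "hsum2 n" "1 / (of_nat n + 1)"] show ?thesis by (simp add: power_divide)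
  qed
  finally show ?case .
qed simp

text \<open>The difference of \<open>hsum\<close> is \<open>1/(j+1)\<close>, which absorption
  removes, so the sum without the division by \<open>j+1\<close> is \<open>-1/(n+1)\<close>.
  \<open>alt_binom_sum_div_Suc\<close> then adds \<open>-1/(n+1)^2\<close> at each step.\<close>

lemma sum_alt_binom_hsum:
  "(\<Sum>j<n. alt_binom n (Suc j) * hsum (Suc j) / (of_nat j + 1)) = - hsum2 n"
proof (induction n)
  case (Suc n)
  have "(\<Sum>j\<le>n. alt_binom n j * (hsum (Suc j) - hsum j)) = (\<Sum>j<Suc n. - alt_binom (Suc n) (Suc j)) / (of_nat n + 1)"
    by (simp add: alt_binom_div_Suc sum_divide_distrib lessThan_Suc_atMost[symmetric] del: sum.lessThan_Suc)
  also have "\<dots> = 1 / (of_nat n + 1)"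
    using alt_binom_sum_shift[of "Suc n" "\<lambda>_. 1"] sum_alt_binom[of n]
    by (simp add: sum_negf del: sum.lessThan_Suc sum.atMost_Suc)
  finally have "(\<Sum>j<Suc n. alt_binom (Suc n) (Suc j) * hsum (Suc j)) = - 1 / (of_nat n + 1)"
    using alt_binom_sum_shift[of "Suc n" hsum] alt_binom_sum_Suc[of n hsum]
    by (simp del: sum.lessThan_Suc sum.atMost_Suc hsum_simps(2))
  thus ?case
    using alt_binom_sum_div_Suc[of n "\<lambda>j. hsum (Suc j)"] Suc
    by (simp add: power2_eq_square del: sum.lessThan_Suc hsum_simps)
qed simp

section \<open>Wallis sums\<close>

text \<open>This is the integral of \<open>(1 - x^2)^n\<close> over the unit interval, expanded by
  the binomial theorem.\<close>

definition wallis :: "nat \<Rightarrow> rat" where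
  "wallis n = (\<Sum>j\<le>n. alt_binom n j / (2 * of_nat j + 1))"

lemma wallis_0 [simp]: "wallis 0 = 1"
  by (simp add: wallis_def)

text \<open>Split \<open>2*n+3\<close> as \<open>(2*j+1) + 2*(n+1-j)\<close>: the first part cancels
  the denominator and leaves a vanishing alternating sum, the second is absorbed into
  \<open>alt_binom n j\<close>.\<close>

lemma wallis_Suc: "(2 * of_nat n + 3) * wallis (Suc n) = (2 * of_nat n + 2) * wallis n"
proof -
  have "(2 * of_nat n + 3) * (alt_binom (Suc n) j / (2 * of_nat j + 1)) =
      alt_binom (Suc n) j + (2 * of_nat n + 2) * (alt_binom n j / (2 * of_nat j + 1))" for j
  proof -
    have "(2 * of_nat n + 3) * alt_binom (Suc n) j = (2 * of_nat j + 1) * alt_binom (Suc n) j + (2 * of_nat n + 2) * alt_binom n j"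
      using alt_binom_Suc_left[of n j] by (simp add: algebra_simps)
    hence "(2 * of_nat n + 3) * alt_binom (Suc n) j / (2 * of_nat j + 1) =
       ((2 * of_nat j + 1) * alt_binom (Suc n) j + (2 * of_nat n + 2) * alt_binom n j) / (2 * of_nat j + 1)" by (simp only:)
    thus ?thesis by (simp add: add_divide_distrib)
  qed
  hence "(2 * of_nat n + 3) * wallis (Suc n) =
     (\<Sum>j\<le>Suc n. alt_binom (Suc n) j) + (2 * of_nat n + 2) * (\<Sum>j\<le>Suc n. alt_binom n j / (2 * of_nat j + 1))"
    unfolding wallis_def sum_distrib_left by (simp only: sum.distrib)
  thus ?thesis by (simp only: sum_alt_binom) (simp add: wallis_def alt_binom_eq_0)
qed

lemma wallis_eq: "wallis n = 4^n / ((2 * of_nat n + 1) * of_nat ((2*n) choose n))"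
proof (induction n)
  case (Suc n)
  define M C C' :: rat where "M = of_nat n" and "C = of_nat ((2*n) choose n)" and "C' = of_nat ((2 * Suc n) choose (Suc n))"
  have nz: "M + 1 \<noteq> 0" "2 * M + 1 \<noteq> 0" "2 * M + 3 \<noteq> 0" "C \<noteq> 0" "C' \<noteq> 0"
    unfolding M_def C_def C'_def using of_nat_0_le_iff[of n, where 'a=rat]
    by (linarith | simp add: binomial_eq_0_iff del: binomial_Suc_Suc)+
  have C': "C' = 2 * (2 * M + 1) * C / (M + 1)"
    using central_binomial_rat_Suc[of n] nz unfolding M_def C_def C'_def
    by (simp add: eq_divide_eq mult.commute del: binomial_Suc_Suc mult_Suc_right)
  have "(2 * M + 3) * wallis (Suc n) = (2 * M + 2) * (4^n / ((2 * M + 1) * C))"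
    using wallis_Suc[of n] Suc by (simp add: M_def C_def)
  hence "wallis (Suc n) = (2 * M + 2) * (4^n / ((2 * M + 1) * C)) / (2 * M + 3)"
    by (intro eq_divide_imp nz) (simp only: mult.commute)
  also have "\<dots> = 4^Suc n / ((2 * M + 3) * C')"
  proof -
    have "(2 * M + 2) * (f / (a * C)) / b = 4 * f / (b * (2 * a * C / d))"
      if "2 * M + 2 = 2 * d" "a \<noteq> 0" "b \<noteq> 0" "d \<noteq> 0" for a b d f :: rat
      unfolding that(1) using that nz by (simp add: field_simps)
    from this[of "M + 1" "2 * M + 1" "2 * M + 3" "4 ^ n"] show ?thesis unfolding C' using nz by simp
  qed
  finally show ?case by (simp add: M_def C'_def del: binomial_Suc_Suc mult_Suc_right)
qed simp

text \<open>The difference of \<open>osum\<close> is \<open>1/(2*j+1)\<close>, so its alternating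
  binomial sum is \<open>- wallis n\<close>; \<open>alt_binom_sum_div_Suc\<close> accumulates these
  values.\<close>

lemma sum_alt_binom_osum:
  "(\<Sum>j<n. alt_binom n (Suc j) * osum (Suc j) / (of_nat j + 1)) = - (\<Sum>j<n. wallis j / (of_nat j + 1))"
proof (induction n)
  case (Suc n)
  have "(\<Sum>j<Suc n. alt_binom (Suc n) (Suc j) * osum (Suc j)) = - wallis n"
    using alt_binom_sum_shift[of "Suc n" osum] alt_binom_sum_Suc[of n osum]
    by (simp add: wallis_def del: sum.lessThan_Suc sum.atMost_Suc osum_simps(2)) simp
  thus ?case
    using alt_binom_sum_div_Suc[of n "\<lambda>j. osum (Suc j)"] Suc by (simp del: osum_simps)
qed simp

section \<open>Sums of reciprocal binomial coefficients\<close>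

text \<open>Up to the factor \<open>1/(n+1)\<close>, each term is a difference of consecutive
  reciprocals \<open>1 / alt_binom n k\<close>, so the sum telescopes.\<close>

lemma sum_inverse_alt_binom:
  "(\<Sum>k<n. 1 / ((of_nat k + 1) * alt_binom n (Suc k))) = ((-1)^n - 1) / (of_nat n + 1)"
proof -
  have "1 / ((of_nat k + 1) * alt_binom n (Suc k)) =
      1 / alt_binom n (Suc k) / (of_nat n + 1) - 1 / alt_binom n k / (of_nat n + 1)" if "k < n" for k
  proof -
    define K N x y :: rat where "K = of_nat k" and "N = of_nat n" and "x = alt_binom n k" and "y = alt_binom n (Suc k)"
    have nz: "K + 1 \<noteq> 0" "N + 1 \<noteq> 0" "x \<noteq> 0" "y \<noteq> 0"
      using that by (simp_all add: K_def N_def x_def y_def alt_binom_nonzero)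
    have "(K + 1) * y = - (N - K) * x"
      using alt_binom_Suc_right[of k n] by (simp add: K_def N_def x_def y_def)
    hence "(N + 1) * x = (K + 1) * (x - y)" by Groebner_Basis.algebra
    hence "(N + 1) * x * y = (K + 1) * (x - y) * y" by (simp only:)
    hence "1 * (x * y * (N + 1)) = (x - y) * ((K + 1) * y)" by (simp only: mult_ac mult_1)
    hence "1 / ((K + 1) * y) = (x - y) / (x * y) / (N + 1)"
      unfolding divide_divide_eq_left using nz by (subst frac_eq_eq) auto
    also have "\<dots> = 1 / y / (N + 1) - 1 / x / (N + 1)"
      unfolding diff_divide_distrib using nz by simp
    finally show ?thesis by (simp add: K_def N_def x_def y_def)
  qed
  hence "(\<Sum>k<n. 1 / ((of_nat k + 1) * alt_binom n (Suc k))) =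
      (\<Sum>k<n. 1 / alt_binom n (Suc k) / (of_nat n + 1) - 1 / alt_binom n k / (of_nat n + 1))"
    by (intro sum.cong) auto
  also have "\<dots> = 1 / alt_binom n n / (of_nat n + 1) - 1 / alt_binom n 0 / (of_nat n + 1)"
    by (rule sum_lessThan_telescope)
  also have "\<dots> = ((-1)^n - 1) / (of_nat n + 1)"
  proof -
    have "1 / (-1)^n = ((-1)^n :: rat)" by (cases "even n") simp_all
    thus ?thesis by (simp add: alt_binom_self diff_divide_distrib)
  qed
  finally show ?thesis .
qed

text \<open>Raising \<open>n\<close> changes each term by a term of
  \<open>sum_inverse_alt_binom\<close> divided by \<open>n + 1\<close>. The sign in that closed form
  is the origin of the alternating sum \<open>A\<close> in the final congruence.\<close>

lemma sum_inverse_square_alt_binom: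
  "(\<Sum>k<n. 1 / ((of_nat k + 1)^2 * alt_binom n (Suc k))) = (\<Sum>k<n. (1 - 2 * (-1)^k) / (of_nat k + 1)^2)"
proof (induction n)
  case (Suc n)
  have "1 / ((of_nat k + 1)^2 * alt_binom (Suc n) (Suc k)) =
      1 / ((of_nat k + 1)^2 * alt_binom n (Suc k)) - 1 / ((of_nat k + 1) * alt_binom n (Suc k)) / (of_nat n + 1)"
    if "k < n" for k
  proof -
    define K N x y :: rat where "K = of_nat k" and "N = of_nat n" and "x = alt_binom n (Suc k)" and "y = alt_binom (Suc n) (Suc k)"
    have nz: "K + 1 \<noteq> 0" "N + 1 \<noteq> 0" "x \<noteq> 0" "y \<noteq> 0"
      using that by (simp_all add: K_def N_def x_def y_def alt_binom_nonzero)
    have "(N - K) * y = (N + 1) * x"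
      using alt_binom_Suc_left[of n "Suc k"] by (simp add: K_def N_def x_def y_def)
    hence "(N + 1) * x = ((N + 1) - (K + 1)) * y" by simp
    hence "1 / y = ((N + 1) - (K + 1)) / ((N + 1) * x)" using nz by (subst frac_eq_eq) auto
    also have "\<dots> = 1 / x - (K + 1) / (x * (N + 1))"
      unfolding diff_divide_distrib using nz by (simp add: mult.commute)
    finally have "1 / y / (K+1)^2 = (1 / x - (K + 1) / (x * (N + 1))) / (K+1)^2" by (simp only:)
    also have "\<dots> = 1 / ((K+1)^2 * x) - 1 / ((K + 1) * x) / (N + 1)"
      using nz by (simp add: diff_divide_distrib power2_eq_square mult_ac)
    finally show ?thesis by (simp add: K_def N_def x_def y_def mult.commute)
  qed
  hence "(\<Sum>k<n. 1 / ((of_nat k + 1)^2 * alt_binom (Suc n) (Suc k))) =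
      (\<Sum>k<n. (1 - 2 * (-1)^k) / (of_nat k + 1)^2) - ((-1)^n - 1) / (of_nat n + 1) / (of_nat n + 1)"
    by (simp only: Suc.IH[symmetric] sum_inverse_alt_binom[symmetric] sum_divide_distrib sum_subtractf[symmetric]) simp
  moreover have "1 / ((of_nat n + 1)^2 * alt_binom (Suc n) (Suc n)) - ((-1)^n - 1) / (of_nat n + 1) / (of_nat n + 1)
      = (1 - 2 * (-1)^n) / (of_nat n + 1 :: rat)^2"
  proof -
    have "1 / (d^2 * - t) - (t - 1) / d / d = (1 - 2 * t) / d^2" if "t = 1 \<or> t = -1" for d t :: rat
      using that by (auto simp: power2_eq_square diff_divide_distrib)
    moreover have "(-1)^n = (1::rat) \<or> (-1)^n = (-1::rat)" by (cases "even n") auto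
    moreover have "alt_binom (Suc n) (Suc n) = - ((-1)^n)" by (simp add: alt_binom_self)
    ultimately show ?thesis by presburger
  qed
  ultimately show ?case by simp
qed simp

lemma hsum2_double:
  "hsum2 (2 * n) = (\<Sum>i<n. 1 / (2 * of_nat i + 1)^2) + hsum2 n / 4"
proof (induction n)
  case (Suc n)
  have "(2 + 2 * of_nat n :: rat)^2 = 4 * (of_nat n + 1)^2" by (simp add: power2_eq_square algebra_simps)
  with Suc show ?case by (simp add: add_divide_distrib mult.commute)
qed simp

lemma sum_lessThan_add: "(\<Sum>i<a + b. f i) = (\<Sum>i<a. f i) + (\<Sum>i<b. f (a + i) :: 'a::comm_monoid_add)" for a b :: nat
  by (induction b) (simp_all add: add_ac)

lemma prod_lessThan_add: "(\<Prod>i<a + b. f i) = (\<Prod>i<a. f i) * (\<Prod>i<b. f (a + i) :: 'a::comm_monoid_mult)" for a b :: nat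
  by (induction b) (simp_all add: mult_ac)

text \<open>The numerator \<open>n + 1\<close> is the point of this form: it becomes
  \<open>p\<close> for \<open>n = 2*m\<close> and \<open>2*p\<close> for
  \<open>n = 4*m + 1\<close>.\<close>

lemma alt_binom_eq_prod: "alt_binom n k = (\<Prod>i<k. 1 - (of_nat n + 1) / (of_nat i + 1))"
proof (induction k)
  case (Suc k)
  have "alt_binom n (Suc k) = alt_binom n k * (- (of_nat n - of_nat k) / (of_nat k + 1))"
    using alt_binom_Suc_right[of k n] by (simp add: field_simps)
  also have "- (of_nat n - of_nat k) / (of_nat k + 1) = 1 - (of_nat n + 1) / (of_nat k + 1 :: rat)"
    by (simp add: field_simps)
  finally show ?case by (simp add: Suc)
qed simp

lemma binomial_eq_prod: "of_nat ((n + k) choose k) = (\<Prod>i<k. 1 + of_nat n / (of_nat i + 1) :: rat)"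
proof (induction k)
  case (Suc k)
  have "(of_nat k + 1) * of_nat ((n + Suc k) choose Suc k) = (of_nat n + of_nat k + 1) * (of_nat ((n + k) choose k) :: rat)"
    using binomial_rat_Suc_Suc[of k "n + k"] by simp
  hence "of_nat ((n + Suc k) choose Suc k) = of_nat ((n + k) choose k) * ((of_nat n + of_nat k + 1) / (of_nat k + 1) :: rat)"
    by (simp add: field_simps del: binomial_Suc_Suc add_Suc_right)
  also have "(of_nat n + of_nat k + 1) / (of_nat k + 1) = 1 + of_nat n / (of_nat k + 1 :: rat)"
    by (simp add: field_simps)
  finally show ?case by (simp add: Suc del: binomial_Suc_Suc add_Suc_right)
qed simp

section \<open>Euler numbers\<close>

text \<open>Multiplying the defining equation by \<open>exp(-t)\<close> shows that the generating
  function is the reciprocal of cosh.\<close>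

lemma euler_fps_cosh: "(euler_fps :: rat fps) * (fps_exp 1 + fps_exp (-1)) = 2"
proof -
  have e0: "fps_exp 1 * fps_exp (-1) = (1 :: rat fps)"
    using fps_exp_add_mult[of "1::rat" "-1"] by simp
  have "fps_exp 2 * fps_exp (-1) = (fps_exp 1 :: rat fps)"
    using fps_exp_add_mult[of "2::rat" "-1"] by simp
  hence "euler_fps * (fps_exp 1 + fps_exp (-1)) = (euler_fps * (fps_exp 2 + 1)) * (fps_exp (-1) :: rat fps)"
    by (simp add: distrib_left distrib_right mult.assoc)
  also have "\<dots> = 2" by (simp add: euler_fps_mult mult.assoc e0)
  finally show ?thesis .
qed

section \<open>Euler polynomials and alternating power sums\<close>

text \<open>In classical notation this is \<open>2^n * E_n((y+1)/2)\<close>. The rescaling makes the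
  value at \<open>0\<close> equal to the Euler number itself, without powers of 2.\<close>

definition euler_poly :: "nat \<Rightarrow> rat \<Rightarrow> rat" where
  "euler_poly n y = fact n * fps_nth (euler_fps * fps_exp y) n"

lemma euler_poly_eq: "euler_poly n y = (\<Sum>i\<le>n. of_nat (n choose i) * euler_number i * y ^ (n - i))"
  unfolding euler_poly_def fps_mult_nth sum_distrib_left atMost_atLeast0
  by (rule sum.cong) (auto simp: euler_number_eq binomial_fact)

lemma euler_poly_diff: "euler_poly n (y + 1) + euler_poly n (y - 1) = 2 * y ^ n"
proof -
  have "fps_exp (y + 1) + fps_exp (y - 1) = (fps_exp 1 + fps_exp (-1)) * fps_exp y"
    using fps_exp_add_mult[of y 1] fps_exp_add_mult[of y "-1"] by (simp add: algebra_simps)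
  hence "euler_fps * fps_exp (y + 1) + euler_fps * fps_exp (y - 1) = 2 * fps_exp y"
    by (simp only: distrib_left[symmetric] mult.assoc[symmetric] euler_fps_cosh)
  hence "fact n * fps_nth (euler_fps * fps_exp (y + 1) + euler_fps * fps_exp (y - 1)) n = fact n * fps_nth (2 * fps_exp y) n"
    by simp
  thus ?thesis by (simp add: euler_poly_def distrib_left numeral_fps_const)
qed

text \<open>This is \<open>euler_poly_diff\<close> at \<open>y = 0\<close>: the weight
  \<open>1 + (-1)^(n-i)\<close> removes the odd differences \<open>n - i\<close>. Integrality and
  the vanishing at odd indices both follow from it by induction.\<close>

lemma euler_number_rec:
  "euler_number n = (if n = 0 then 1 else 0) - (\<Sum>i | i < n \<and> even (n - i). of_nat (n choose i) * euler_number i)"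
proof -
  have "2 * (0::rat) ^ n = (\<Sum>i\<le>n. of_nat (n choose i) * euler_number i * (1 + (-1) ^ (n - i)))"
    using euler_poly_diff[of n 0] unfolding euler_poly_eq by (simp add: distrib_left sum.distrib)
  also have "\<dots> = (\<Sum>i\<le>n. if even (n - i) then 2 * (of_nat (n choose i) * euler_number i) else 0)"
    by (rule sum.cong) auto
  also have "\<dots> = (\<Sum>i | i \<le> n \<and> even (n - i). 2 * (of_nat (n choose i) * euler_number i))"
    by (subst sum.inter_filter[symmetric]) (auto intro!: sum.cong)
  also have "{i. i \<le> n \<and> even (n - i)} = insert n {i. i < n \<and> even (n - i)}" by auto
  also have "(\<Sum>i\<in>insert n {i. i < n \<and> even (n - i)}. 2 * (of_nat (n choose i) * euler_number i)) =
      2 * (euler_number n + (\<Sum>i | i < n \<and> even (n - i). of_nat (n choose i) * euler_number i))"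
    by (simp add: sum_distrib_left)
  finally show ?thesis by (cases n) auto
qed

lemma euler_number_Ints: "euler_number n \<in> \<int>"
proof (induction n rule: less_induct)
  case (less n)
  show ?case
    by (subst euler_number_rec) (auto intro!: Ints_diff Ints_sum Ints_mult less.IH)
qed

lemma euler_number_odd: "odd n \<Longrightarrow> euler_number n = 0"
proof (induction n rule: less_induct)
  case (less n)
  have "(\<Sum>i | i < n \<and> even (n - i). of_nat (n choose i) * euler_number i) = 0"
    using less by (intro sum.neutral) auto
  moreover have "n \<noteq> 0" using less.prems by (cases n) auto
  ultimately show ?case using euler_number_rec[of n] by simp
qed

text \<open>For even \<open>n\<close> the odd-index terms vanish anyway, so the value at 1 is
  exactly the combination that the recurrence sets to zero. This removes the lower boundary term in
  \<open>alternating_power_sum\<close>.\<close>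

lemma euler_poly_1: "even n \<Longrightarrow> n \<noteq> 0 \<Longrightarrow> euler_poly n 1 = 0"
proof -
  assume n: "even n" "n \<noteq> 0"
  have "(\<Sum>i<n. of_nat (n choose i) * euler_number i) = (\<Sum>i | i < n \<and> even (n - i). of_nat (n choose i) * euler_number i)"
    using n by (intro sum.mono_neutral_right) (auto simp: euler_number_odd)
  thus ?thesis
    using euler_number_rec[of n] n by (simp add: euler_poly_eq lessThan_Suc_atMost[symmetric])
qed

text \<open>By \<open>euler_poly_diff\<close> the sum telescopes along the odd arguments
  \<open>1, 3, ..., 2*m+1\<close>, the last of which is the prime \<open>p\<close> in the
  application.\<close>

lemma alternating_power_sum:
  assumes "even n" "n \<noteq> 0"
  shows "(\<Sum>k<m. (-1)^Suc k * (2 * (2 * (of_nat k + 1))^n)) = (-1)^m * euler_poly n (2 * of_nat m + 1)"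
proof -
  define g where "g k = (-1)^k * euler_poly n (2 * of_nat k + 1)" for k
  have "(-1)^Suc k * (2 * (2 * (of_nat k + 1))^n) = g (Suc k) - g k" for k
  proof -
    have "g (Suc k) - g k = (-1)^Suc k * (euler_poly n (2 * (of_nat k + 1) + 1) + euler_poly n (2 * (of_nat k + 1) - 1))"
      by (simp add: g_def algebra_simps)
    thus ?thesis unfolding euler_poly_diff by simp
  qed
  hence "(\<Sum>k<m. (-1)^Suc k * (2 * (2 * (of_nat k + 1))^n)) = (\<Sum>k<m. g (Suc k) - g k)" by simp
  also have "\<dots> = g m - g 0" by (rule sum_lessThan_telescope)
  also have "g 0 = 0" using assms by (simp add: g_def euler_poly_1)
  finally show ?thesis by (simp add: g_def)
qed

section \<open>Congruences between rational numbers\<close>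

locale prime_gt_3 =
  fixes p m :: nat
  assumes prime: "prime p" and p_eq: "p = 2 * m + 1" and m_ge: "m \<ge> 2"
begin

abbreviation P :: rat where "P \<equiv> of_nat p"

text \<open>The ring of integers localized at \<open>p\<close>; \<open>punit\<close> below describes
  its unit group.\<close>

definition pint :: "rat set" where "pint = {x. denom_coprime p x}"

definition punit :: "rat \<Rightarrow> bool" where
  "punit x \<longleftrightarrow> (\<exists>a b. \<not> int p dvd a \<and> \<not> int p dvd b \<and> x = of_int a / of_int b)"

text \<open>Only the difference has to be p-integral, so the additive rules need no side conditions;
  integrality of the two sides enters again in \<open>rat_congI\<close>.\<close>

definition pcong :: "nat \<Rightarrow> rat \<Rightarrow> rat \<Rightarrow> bool" where
  "pcong n x y \<longleftrightarrow> (\<exists>r\<in>pint. x = y + P ^ n * r)"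

lemma prime_int: "prime (int p)"
  using prime by simp

lemma p_gt_3: "p > 3"
  using p_eq m_ge by simp

lemma P_nonzero [simp]: "P \<noteq> 0" "0 < p"
  using p_gt_3 by simp_all

text \<open>The denominator in lowest terms divides every other denominator, so any fraction with
  denominator prime to \<open>p\<close> can serve as a witness. Closure under sums and products then
  needs no reduction of fractions.\<close>

lemma pint_iff: "x \<in> pint \<longleftrightarrow> (\<exists>a b. \<not> int p dvd b \<and> x = of_int a / of_int b)"
proof
  assume x: "x \<in> pint"
  obtain a b where ab: "quotient_of x = (a, b)" by fastforce
  with x have "coprime b (int p)" by (simp add: pint_def denom_coprime_def)
  hence "\<not> int p dvd b"
    using prime_int by (meson coprime_common_divisor dvd_refl not_prime_unit)
  thus "\<exists>a b. \<not> int p dvd b \<and> x = of_int a / of_int b"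
    using quotient_of_div[OF ab] by blast
next
  assume "\<exists>a b. \<not> int p dvd b \<and> x = of_int a / of_int b"
  then obtain a b where ab: "\<not> int p dvd b" "x = of_int a / of_int b" by blast
  obtain c d where cd: "quotient_of x = (c, d)" by fastforce
  have b0: "b \<noteq> 0" using ab(1) by auto
  have d0: "d > 0" using quotient_of_denom_pos[OF cd] .
  have "of_int c / of_int d = (of_int a / of_int b :: rat)"
    using quotient_of_div[OF cd] ab(2) by simp
  hence "of_int c * of_int b = (of_int a * of_int d :: rat)"
    using b0 d0 by (simp add: frac_eq_eq)
  hence "c * b = a * d" by (metis of_int_eq_iff of_int_mult)
  hence "d dvd c * b" by simp
  moreover have "coprime d c" using quotient_of_coprime[OF cd] by (simp add: coprime_commute)
  ultimately have "d dvd b" by (simp add: coprime_dvd_mult_right_iff)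
  hence "\<not> int p dvd d" using ab(1) dvd_trans by blast
  hence "coprime (int p) d" using prime_int by (simp add: prime_imp_coprime)
  thus "x \<in> pint" by (simp add: pint_def denom_coprime_def cd coprime_commute)
qed

lemma not_dvd_mult: "\<not> int p dvd a \<Longrightarrow> \<not> int p dvd b \<Longrightarrow> \<not> int p dvd a * b"
  using prime_int by (simp add: prime_dvd_mult_iff)

lemma pint_of_int [simp]: "of_int a \<in> pint"
  unfolding pint_iff using prime_int not_prime_unit by (intro exI[of _ a] exI[of _ 1]) auto

lemma pint_of_nat [simp]: "of_nat a \<in> pint"
  using pint_of_int[of "int a"] by simp

lemma pint_numeral [simp]: "numeral k \<in> pint" "0 \<in> pint" "1 \<in> pint"
  using pint_of_int[of "numeral k"] pint_of_int[of 0] pint_of_int[of 1] by simp_all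

lemma pint_add [simp]: "x \<in> pint \<Longrightarrow> y \<in> pint \<Longrightarrow> x + y \<in> pint"
proof -
  assume "x \<in> pint" "y \<in> pint"
  then obtain a b c d where *: "\<not> int p dvd b" "x = of_int a / of_int b" "\<not> int p dvd d" "y = of_int c / of_int d"
    unfolding pint_iff by blast
  hence "b \<noteq> 0" "d \<noteq> 0" by auto
  hence "x + y = of_int (a * d + c * b) / of_int (b * d)" using * by (simp add: add_frac_eq)
  thus ?thesis unfolding pint_iff using * not_dvd_mult by blast
qed

lemma pint_mult [simp]: "x \<in> pint \<Longrightarrow> y \<in> pint \<Longrightarrow> x * y \<in> pint"
proof -
  assume "x \<in> pint" "y \<in> pint"
  then obtain a b c d where *: "\<not> int p dvd b" "x = of_int a / of_int b" "\<not> int p dvd d" "y = of_int c / of_int d"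
    unfolding pint_iff by blast
  hence "x * y = of_int (a * c) / of_int (b * d)" by simp
  thus ?thesis unfolding pint_iff using * not_dvd_mult by blast
qed

lemma pint_minus [simp]: "x \<in> pint \<Longrightarrow> - x \<in> pint"
  using pint_mult[of "-1" x] pint_of_int[of "-1"] by simp

lemma pint_diff [simp]: "x \<in> pint \<Longrightarrow> y \<in> pint \<Longrightarrow> x - y \<in> pint"
  using pint_add[of x "-y"] by simp

lemma pint_power [simp]: "x \<in> pint \<Longrightarrow> x ^ n \<in> pint"
  by (induction n) auto

lemma pint_sum [simp]: "(\<And>i. i \<in> A \<Longrightarrow> f i \<in> pint) \<Longrightarrow> sum f A \<in> pint"
  by (induction A rule: infinite_finite_induct) auto

lemma punit_nonzero: "punit x \<Longrightarrow> x \<noteq> 0"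
  unfolding punit_def by fastforce

lemma punit_pint: "punit x \<Longrightarrow> x \<in> pint"
  unfolding punit_def pint_iff by blast

lemma punit_inverse: "punit x \<Longrightarrow> punit (1 / x)"
  unfolding punit_def by (metis divide_divide_eq_right mult.left_neutral)

lemma pint_divide [simp]: "x \<in> pint \<Longrightarrow> punit y \<Longrightarrow> x / y \<in> pint"
  using pint_mult[of x "1 / y"] punit_pint[OF punit_inverse[of y]] by simp

lemma punit_mult [simp]: "punit x \<Longrightarrow> punit y \<Longrightarrow> punit (x * y)"
proof -
  assume "punit x" "punit y"
  then obtain a b c d where *: "\<not> int p dvd b" "\<not> int p dvd a" "x = of_int a / of_int b" "\<not> int p dvd d" "\<not> int p dvd c" "y = of_int c / of_int d"
    unfolding punit_def by blast
  hence "x * y = of_int (a * c) / of_int (b * d)" by simp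
  thus ?thesis unfolding punit_def using * not_dvd_mult by blast
qed

lemma punit_of_int: "\<not> int p dvd a \<Longrightarrow> punit (of_int a)"
  unfolding punit_def using prime_int not_prime_unit by (intro exI[of _ a] exI[of _ 1]) auto

lemma punit_1 [simp]: "punit 1"
  using punit_of_int[of 1] prime_int not_prime_unit by auto

lemma punit_power [simp]: "punit x \<Longrightarrow> punit (x ^ n)"
  by (induction n) auto

lemma punit_minus [simp]: "punit (- x) \<longleftrightarrow> punit x"
proof -
  have "punit (-1)" using punit_of_int[of "-1"] prime_int not_prime_unit by auto
  thus ?thesis using punit_mult[of "-1" x] punit_mult[of "-1" "-x"] by auto
qed

lemma punit_divide [simp]: "punit x \<Longrightarrow> punit y \<Longrightarrow> punit (x / y)"
  using punit_mult[of x "1 / y"] punit_inverse[of y] by simp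

lemma punit_of_nat: "0 < k \<Longrightarrow> k < p \<Longrightarrow> punit (of_nat k)"
  using punit_of_int[of "int k"] by (simp add: nat_dvd_not_less)

lemma punit_2 [simp]: "punit 2" and punit_3 [simp]: "punit 3"
  using punit_of_nat[of 2] punit_of_nat[of 3] p_gt_3 by simp_all

lemma punit_4 [simp]: "punit 4" and punit_8 [simp]: "punit 8" and punit_16 [simp]: "punit 16"
  and punit_64 [simp]: "punit 64"
  using punit_power[OF punit_2, of 2] punit_power[OF punit_2, of 3] punit_power[OF punit_2, of 4]
    punit_power[OF punit_2, of 6] by simp_all

lemma punit_add: "punit y \<Longrightarrow> r \<in> pint \<Longrightarrow> punit (y + P * r)"
proof -
  assume "punit y" "r \<in> pint"
  then obtain a b c d where *: "\<not> int p dvd b" "\<not> int p dvd a" "y = of_int a / of_int b" "\<not> int p dvd d" "r = of_int c / of_int d"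
    unfolding punit_def pint_iff by blast
  hence "b \<noteq> 0" "d \<noteq> 0" by auto
  hence "y + P * r = of_int (a * d + int p * (c * b)) / of_int (b * d)" using * by (simp add: add_frac_eq mult_ac)
  moreover have "\<not> int p dvd a * d + int p * (c * b)"
    using not_dvd_mult[of a d] * by (simp add: dvd_add_left_iff)
  ultimately show ?thesis unfolding punit_def using * not_dvd_mult by blast
qed

lemma pcongI: "x = y + P ^ n * r \<Longrightarrow> r \<in> pint \<Longrightarrow> pcong n x y"
  unfolding pcong_def by blast

lemma pcongE:
  assumes "pcong n x y" obtains r where "r \<in> pint" "x = y + P ^ n * r"
  using assms unfolding pcong_def by blast

lemma pcong_refl [simp]: "pcong n x x"
  by (rule pcongI[of _ _ _ 0]) auto

lemma pcong_sym: "pcong n x y \<Longrightarrow> pcong n y x"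
  by (erule pcongE, rule pcongI[of _ _ _ "- _"]) auto

lemma pcong_trans [trans]: "pcong n x y \<Longrightarrow> pcong n y z \<Longrightarrow> pcong n x z"
  by (elim pcongE, rule pcongI[of _ _ _ "_ + _"]) (auto simp: algebra_simps)

lemma pcong_add: "pcong n x y \<Longrightarrow> pcong n x' y' \<Longrightarrow> pcong n (x + x') (y + y')"
  by (elim pcongE, rule pcongI[of _ _ _ "_ + _"]) (auto simp: algebra_simps)

lemma pcong_minus: "pcong n x y \<Longrightarrow> pcong n (- x) (- y)"
  by (elim pcongE, rule pcongI[of _ _ _ "- _"]) (auto simp: algebra_simps)

lemma pcong_diff: "pcong n x y \<Longrightarrow> pcong n x' y' \<Longrightarrow> pcong n (x - x') (y - y')"
  using pcong_add[of n x y "-x'" "-y'"] pcong_minus[of n x' y'] by simp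

lemma pcong_mult_left: "pcong n x y \<Longrightarrow> c \<in> pint \<Longrightarrow> pcong n (c * x) (c * y)"
  by (elim pcongE, rule pcongI[of _ _ _ "c * _"]) (auto simp: algebra_simps)

lemma pcong_mult_right: "pcong n x y \<Longrightarrow> c \<in> pint \<Longrightarrow> pcong n (x * c) (y * c)"
  using pcong_mult_left[of n x y c] by (simp add: mult.commute)

lemma pcong_mult: "pcong n x y \<Longrightarrow> pcong n x' y' \<Longrightarrow> y \<in> pint \<Longrightarrow> x' \<in> pint \<Longrightarrow> pcong n (x * x') (y * y')"
  by (meson pcong_mult_left pcong_mult_right pcong_trans)

lemma pcong_divide: "pcong n x y \<Longrightarrow> punit c \<Longrightarrow> pcong n (x / c) (y / c)"
  using pcong_mult_right[of n x y "1 / c"] punit_pint[OF punit_inverse[of c]] by simp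

lemma pcong_sum: "(\<And>i. i \<in> A \<Longrightarrow> pcong n (f i) (g i)) \<Longrightarrow> pcong n (sum f A) (sum g A)"
  by (induction A rule: infinite_finite_induct) (auto intro: pcong_add)

lemma pcong_mono: "pcong n x y \<Longrightarrow> k \<le> n \<Longrightarrow> pcong k x y"
  by (elim pcongE, rule pcongI[of _ _ _ "P ^ (n - k) * _"]) (auto simp flip: power_add mult.assoc)

lemma pcong_scale: "pcong n x y \<Longrightarrow> pcong (Suc n) (P * x) (P * y)"
  by (elim pcongE, rule pcongI) (auto simp: algebra_simps)

lemma pcong_scale_1: "pcong 1 x y \<Longrightarrow> pcong 2 (P * x) (P * y)"
  and pcong_scale_2: "pcong 2 x y \<Longrightarrow> pcong 3 (P * x) (P * y)"
  and pcong_scale_3: "pcong 3 x y \<Longrightarrow> pcong 4 (P * x) (P * y)"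
  using pcong_scale[of 1 x y] pcong_scale[of 2 x y] pcong_scale[of 3 x y] by (simp_all add: eval_nat_numeral)

lemma pcong_pint: "pcong n x y \<Longrightarrow> y \<in> pint \<Longrightarrow> x \<in> pint"
  by (elim pcongE) auto

lemma pcong_punit: "pcong (Suc n) x y \<Longrightarrow> punit y \<Longrightarrow> punit x"
  using punit_add[of y] by (elim pcongE) (auto simp: mult.assoc)

lemma pcong_cancel: "pcong n (c * x) (c * y) \<Longrightarrow> punit c \<Longrightarrow> pcong n x y"
  using pcong_divide[of n "c * x" "c * y" c] punit_nonzero[of c] by simp

lemma pcong_inverse:
  assumes "pcong n x y" "punit x" "punit y" shows "pcong n (1 / x) (1 / y)"
proof -
  have "pcong n (y / (x * y)) (x / (x * y))"
    using assms by (intro pcong_divide pcong_sym[OF assms(1)]) auto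
  thus ?thesis using punit_nonzero[OF assms(2)] punit_nonzero[OF assms(3)] by simp
qed

lemma rat_congI:
  assumes "y \<in> pint" "pcong n x y" shows "rat_cong p n x y"
proof -
  obtain r where r: "r \<in> pint" "x = y + P ^ n * r" using assms(2) by (rule pcongE)
  have "x \<in> pint" using assms by (rule pcong_pint[rotated])
  moreover have "(x - y) / P ^ n = r" using r(2) P_nonzero by (simp del: of_nat_eq_0_iff)
  ultimately show ?thesis unfolding rat_cong_def using assms(1) r(1) by (simp add: pint_def)
qed

section \<open>Harmonic sums and Wolstenholme's theorem\<close>

abbreviation H :: rat where "H \<equiv> hsum m"

lemma P_eq: "P = 2 * of_nat m + 1"
  by (simp add: p_eq)

lemma punit_Suc: "i < 2 * m \<Longrightarrow> punit (of_nat i + 1)"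
  using punit_of_nat[of "Suc i"] p_eq by (simp add: add.commute)

lemma punit_odd: "i < m \<Longrightarrow> punit (2 * of_nat i + 1)"
  using punit_of_nat[of "Suc (2 * i)"] p_eq by (simp add: add.commute)

lemma pint_hsum: "n \<le> 2 * m \<Longrightarrow> hsum n \<in> pint"
  unfolding hsum_def using punit_Suc by (intro pint_sum pint_divide) auto

lemma pint_hsum2: "n \<le> 2 * m \<Longrightarrow> hsum2 n \<in> pint"
  unfolding hsum2_def using punit_Suc by (intro pint_sum pint_divide punit_power) auto

lemma pint_osum: "n \<le> m \<Longrightarrow> osum n \<in> pint"
  unfolding osum_def using punit_odd by (intro pint_sum pint_divide) auto

lemma pint_H [simp]: "H \<in> pint"
  by (rule pint_hsum) simp

lemma pcong_inverse_square_reflect: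
  assumes "punit x" shows "pcong 1 (1 / (P - x)^2) (1 / x^2)"
proof (rule pcong_inverse)
  show c: "pcong 1 ((P - x)^2) (x^2)"
    using punit_pint[OF assms] by (intro pcongI[of _ _ _ "P - 2 * x"]) (auto simp: power2_eq_square algebra_simps)
  show "punit (x^2)" using assms by simp
  with c show "punit ((P - x)^2)" using pcong_punit[of 0] by simp
qed

lemma sum_reflect_m: "(\<Sum>i<m. f i) = (\<Sum>i<m. f (m - Suc i))"
  by (rule sum.nat_diff_reindex[symmetric])

text \<open>\<open>hsum2 (2*m)\<close> is computed twice modulo \<open>p\<close>. Reflecting the
  upper half gives \<open>2 * hsum2 m\<close>; splitting by parity and reflecting the odd
  denominators gives \<open>hsum2 m / 2\<close>. The difference has coefficient \<open>3/2\<close>,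
  a unit because \<open>p > 3\<close>.\<close>

lemma hsum2_m: "pcong 1 (hsum2 m) 0"
proof -
  have cast: "of_nat (m - Suc i) = (of_nat m - of_nat i - 1 :: rat)" if "i < m" for i
    using that by (simp add: of_nat_diff)
  have "hsum2 (2 * m) = hsum2 m + (\<Sum>i<m. 1 / (of_nat (m + i) + 1)^2)"
    unfolding hsum2_def mult_2 by (rule sum_lessThan_add)
  also have "(\<Sum>i<m. 1 / (of_nat (m + i) + 1 :: rat)^2) = (\<Sum>i<m. 1 / (P - (of_nat i + 1))^2)"
    by (subst sum_reflect_m, rule sum.cong) (auto simp: cast P_eq algebra_simps)
  finally have 1: "hsum2 (2 * m) = hsum2 m + (\<Sum>i<m. 1 / (P - (of_nat i + 1))^2)" .
  have "(\<Sum>i<m. 1 / (2 * of_nat i + 1 :: rat)^2) = (\<Sum>i<m. 1 / (P - 2 * (of_nat i + 1))^2)"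
    by (subst sum_reflect_m, rule sum.cong) (auto simp: cast P_eq algebra_simps)
  hence 2: "hsum2 (2 * m) = (\<Sum>i<m. 1 / (P - 2 * (of_nat i + 1))^2) + hsum2 m / 4"
    unfolding hsum2_double by simp
  have u: "punit (of_nat i + 1)" if "i < m" for i using that by (intro punit_Suc) auto
  have "pcong 1 (\<Sum>i<m. 1 / (P - (of_nat i + 1))^2) (hsum2 m)"
    unfolding hsum2_def by (intro pcong_sum pcong_inverse_square_reflect u) auto
  hence c1: "pcong 1 (hsum2 (2 * m)) (hsum2 m + hsum2 m)"
    unfolding 1 by (intro pcong_add) auto
  have "pcong 1 (\<Sum>i<m. 1 / (P - 2 * (of_nat i + 1))^2) (\<Sum>i<m. 1 / (2 * (of_nat i + 1))^2)"
    by (intro pcong_sum pcong_inverse_square_reflect punit_mult u) auto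
  also have "(\<Sum>i<m. 1 / (2 * (of_nat i + 1) :: rat)^2) = hsum2 m / 4"
    unfolding hsum2_def sum_divide_distrib power_mult_distrib by (simp add: mult.commute)
  finally have "pcong 1 (hsum2 (2 * m)) (hsum2 m / 4 + hsum2 m / 4)"
    unfolding 2 by (intro pcong_add) auto
  hence "pcong 1 (hsum2 m + hsum2 m) (hsum2 m / 4 + hsum2 m / 4)"
    by (rule pcong_trans[OF pcong_sym[OF c1]])
  from pcong_diff[OF this pcong_refl[of 1 "hsum2 m / 4 + hsum2 m / 4"]]
  have "pcong 1 ((3 / 2) * hsum2 m) ((3 / 2) * 0)" by simp
  thus ?thesis by (rule pcong_cancel) simp
qed

text \<open>The coefficients are the first two elementary symmetric functions of
  \<open>1, 1/2, ..., 1/n\<close>; the higher ones carry a factor \<open>P^3\<close>.\<close>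

lemma prod_one_plus:
  assumes "n \<le> 2 * m" "y \<in> pint"
  shows "pcong 3 (\<Prod>i<n. 1 + P * y / (of_nat i + 1))
     (1 + P * y * hsum n + (P * y)^2 * ((hsum n)^2 - hsum2 n) / 2)"
  using assms(1)
proof (induction n)
  case (Suc n)
  define x h h2 r where "x = P * y" and "h = hsum n" and "h2 = hsum2 n" and "r = 1 / (of_nat n + 1 :: rat)"
  have r: "r \<in> pint" unfolding r_def using punit_Suc[of n] Suc.prems by simp
  have h: "h \<in> pint" "h2 \<in> pint" unfolding h_def h2_def using Suc.prems by (auto intro: pint_hsum pint_hsum2)
  have "pcong 3 (\<Prod>i<Suc n. 1 + x / (of_nat i + 1)) ((1 + x * h + x^2 * (h^2 - h2) / 2) * (1 + x * r))"
  proof -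
    have "pcong 3 (\<Prod>i<n. 1 + x / (of_nat i + 1)) (1 + x * h + x^2 * (h^2 - h2) / 2)"
      using Suc by (simp add: x_def h_def h2_def)
    moreover have "1 + x * r \<in> pint" using r assms(2) by (simp add: x_def)
    ultimately have "pcong 3 ((\<Prod>i<n. 1 + x / (of_nat i + 1)) * (1 + x * r)) ((1 + x * h + x^2 * (h^2 - h2) / 2) * (1 + x * r))"
      by (rule pcong_mult_right)
    thus ?thesis by (simp add: r_def)
  qed
  also have "pcong 3 \<dots> (1 + x * (h + r) + x^2 * ((h + r)^2 - (h2 + r^2)) / 2)"
  proof (rule pcongI)
    show "(1 + x * h + x^2 * (h^2 - h2) / 2) * (1 + x * r) =
        1 + x * (h + r) + x^2 * ((h + r)^2 - (h2 + r^2)) / 2 + P^3 * (y^3 * (h^2 - h2) * r / 2)"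
      by (simp add: x_def power2_eq_square power3_eq_cube field_simps)
    show "y^3 * (h^2 - h2) * r / 2 \<in> pint" using h r assms(2) by simp
  qed
  finally show ?case by (simp add: x_def h_def h2_def r_def power_divide)
qed simp

lemma prod_one_plus_m:
  assumes "y \<in> pint"
  shows "pcong 3 (\<Prod>i<m. 1 + P * y / (of_nat i + 1)) (1 + P * y * H + (P * y)^2 * H^2 / 2)"
proof -
  obtain r where r: "r \<in> pint" "hsum2 m = 0 + P^1 * r" using hsum2_m by (rule pcongE)
  have "pcong 3 (\<Prod>i<m. 1 + P * y / (of_nat i + 1)) (1 + P * y * H + (P * y)^2 * (H^2 - hsum2 m) / 2)"
    using prod_one_plus[OF _ assms, of m] by simp
  also have "pcong 3 \<dots> (1 + P * y * H + (P * y)^2 * H^2 / 2)"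
    unfolding r(2) using r(1) assms
    by (intro pcongI[of _ _ _ "- (y^2 * r / 2)"]) (auto simp: power2_eq_square power3_eq_cube field_simps)
  finally show ?thesis .
qed

text \<open>Pairing the factors for \<open>k\<close> and \<open>p - k\<close> gives
  \<open>1 + 2*P^2 / (k*(P-k))\<close>, which is \<open>1 - 2*P^2/k^2\<close> modulo
  \<open>p^3\<close>. The product over \<open>k\<close> then reduces to
  \<open>hsum2_m\<close>.\<close>

lemma wolstenholme: "pcong 3 (of_nat ((2 * p - 1) choose (p - 1))) 1"
proof -
  have cast: "of_nat (m - Suc i) = (of_nat m - of_nat i - 1 :: rat)" if "i < m" for i
    using that by (simp add: of_nat_diff)
  define g where "g i = (1 + P / (of_nat i + 1)) * (1 + P / (P - (of_nat i + 1)))" for i :: nat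
  have "2 * p - 1 = p + 2 * m" "p - 1 = 2 * m" by (simp_all add: p_eq)
  hence "of_nat ((2 * p - 1) choose (p - 1)) = (\<Prod>i<m+m. 1 + P / (of_nat i + 1))"
    by (simp only: binomial_eq_prod mult_2)
  also have "\<dots> = (\<Prod>i<m. 1 + P / (of_nat i + 1)) * (\<Prod>i<m. 1 + P / (of_nat (m + i) + 1))"
    by (rule prod_lessThan_add)
  also have "(\<Prod>i<m. 1 + P / (of_nat (m + i) + 1)) = (\<Prod>i<m. 1 + P / (P - (of_nat i + 1)))"
    by (subst prod.nat_diff_reindex[symmetric], rule prod.cong) (auto simp: cast P_eq algebra_simps)
  also have "(\<Prod>i<m. 1 + P / (of_nat i + 1)) * \<dots> = (\<Prod>i<m. g i)"
    by (simp add: g_def prod.distrib)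
  finally have eq: "of_nat ((2 * p - 1) choose (p - 1)) = (\<Prod>i<m. g i)" .
  have "pcong 3 (\<Prod>i<n. g i) (1 - 2 * P^2 * hsum2 n)" if "n \<le> m" for n
    using that
  proof (induction n)
    case (Suc n)
    define k where "k = (of_nat n + 1 :: rat)"
    have k: "punit k" unfolding k_def using Suc.prems by (intro punit_Suc) simp
    have k': "punit (P - k)"
      using pcong_punit[of 0 "P - k" "- k"] k by (simp add: pcongI[of _ _ _ 1])
    have g: "g n = 1 - 2 * P^2 / k^2 + P^3 * (2 / (k^2 * (P - k)))"
      unfolding g_def k_def[symmetric] using punit_nonzero[OF k] punit_nonzero[OF k']
      by (simp add: field_simps power2_eq_square power3_eq_cube)
    have "pcong 3 (g n) (1 - 2 * P^2 / k^2)"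
      by (rule pcongI[OF g]) (use k k' in simp)
    hence "pcong 3 ((\<Prod>i<n. g i) * g n) ((1 - 2 * P^2 * hsum2 n) * (1 - 2 * P^2 / k^2))"
      using Suc k by (intro pcong_mult) (auto simp: pint_hsum2 intro: pcong_pint)
    also have "pcong 3 \<dots> (1 - 2 * P^2 * (hsum2 n + 1 / k^2))"
      using k pint_hsum2[of n] Suc.prems punit_nonzero[OF k]
      by (intro pcongI[of _ _ _ "4 * P * hsum2 n / k^2"]) (auto simp: power2_eq_square power3_eq_cube field_simps)
    finally show ?case by (simp add: k_def)
  qed simp
  hence "pcong 3 (\<Prod>i<m. g i) (1 - 2 * P^2 * hsum2 m)" by simp
  also obtain r where r: "r \<in> pint" "hsum2 m = 0 + P^1 * r" using hsum2_m by (rule pcongE)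
  have "pcong 3 (1 - 2 * P^2 * hsum2 m) 1"
    unfolding r(2) using r(1) by (intro pcongI[of _ _ _ "- 2 * r"]) (auto simp: power2_eq_square power3_eq_cube)
  finally show ?thesis unfolding eq .
qed

section \<open>Morley's congruence\<close>

lemma central_alt_binom: "pcong 3 (alt_binom (2 * m) m) (1 - P * H + P^2 * H^2 / 2)"
proof -
  have "alt_binom (2 * m) m = (\<Prod>i<m. 1 + P * (-1) / (of_nat i + 1))"
    unfolding alt_binom_eq_prod by (simp add: P_eq[symmetric])
  thus ?thesis using prod_one_plus_m[of "-1"] pint_of_int[of "-1"] by simp
qed

text \<open>Reflection turns the denominators \<open>2*j+1\<close> into \<open>P - 2*j\<close>. The
  term \<open>j = 0\<close> is the only one with \<open>p\<close> in the denominator; the others are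
  expanded to first order and summed by the closed forms in \<open>hsum\<close> and
  \<open>hsum2\<close>.\<close>

lemma wallis_m:
  "pcong 3 ((-1)^m * P * wallis m) (1 + P * H / 2 + P^2 * H^2 / 8)"
proof -
  obtain r where r: "r \<in> pint" "hsum2 m = 0 + P^1 * r" using hsum2_m by (rule pcongE)
  define e where "e j = alt_binom m (Suc j)" for j
  have e: "e j \<in> pint" for j unfolding e_def alt_binom_def by simp
  define D where "D = (\<Sum>j<m. e j / (P - 2 * (of_nat j + 1)))"
  have "wallis m = (\<Sum>j\<le>m. alt_binom m (m - j) / (2 * of_nat (m - j) + 1))"
    unfolding wallis_def by (rule sum.nat_diff_reindex[of _ "Suc m", unfolded lessThan_Suc_atMost, simplified, symmetric])
  also have "\<dots> = (\<Sum>j\<le>m. (-1)^m * (alt_binom m j / (P - 2 * of_nat j)))"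
    by (rule sum.cong) (auto simp: alt_binom_reflect P_eq of_nat_diff algebra_simps)
  also have "\<dots> = (-1)^m * (\<Sum>j\<le>m. alt_binom m j / (P - 2 * of_nat j))"
    by (simp add: sum_distrib_left)
  also have "(\<Sum>j\<le>m. alt_binom m j / (P - 2 * of_nat j)) = 1 / P + D"
    unfolding lessThan_Suc_atMost[symmetric] sum.lessThan_Suc_shift by (simp add: D_def e_def algebra_simps)
  finally have w: "wallis m = (-1)^m * (1 / P + D)" .
  have "(-1)^m * P * wallis m = ((-1)^m * (-1)^m) * (P * (1 / P + D))"
    unfolding w by (simp only: mult_ac)
  also have "P * (1 / P + D) = 1 + P * D" by (simp add: distrib_left)
  finally have eq: "(-1)^m * P * wallis m = 1 + P * D" by (simp flip: power_add)
  \<comment> \<open>The geometric expansion of \<open>1/(P - 2*k)\<close> to first order in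
    \<open>P\<close>.\<close>
  have "pcong 2 (e j / (P - 2 * (of_nat j + 1))) (- (e j / (of_nat j + 1)) / 2 - P / 4 * (e j / (of_nat j + 1)^2))"
    if "j < m" for j
  proof -
    define k where "k = (of_nat j + 1 :: rat)"
    have k: "punit k" unfolding k_def using that by (intro punit_Suc) simp
    have k': "punit (P - 2 * k)"
      using pcong_punit[of 0 "P - 2 * k" "- (2 * k)"] k by (simp add: pcongI[of _ _ _ 1])
    show ?thesis unfolding k_def[symmetric]
    proof (rule pcongI)
      show "e j / (P - 2 * k) = - (e j / k) / 2 - P / 4 * (e j / k^2) + P^2 * (e j / (4 * k^2 * (P - 2 * k)))"
        using punit_nonzero[OF k] punit_nonzero[OF k'] by (simp add: field_simps power2_eq_square)
    qed (use k k' e in simp)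
  qed
  hence "pcong 2 D (\<Sum>j<m. - (e j / (of_nat j + 1)) / 2 - P / 4 * (e j / (of_nat j + 1)^2))"
    unfolding D_def by (intro pcong_sum) auto
  also have "\<dots> = - (\<Sum>j<m. e j / (of_nat j + 1)) / 2 - P / 4 * (\<Sum>j<m. e j / (of_nat j + 1)^2)"
    by (simp add: sum_subtractf sum_negf sum_divide_distrib sum_distrib_left)
  also have "\<dots> = H / 2 + P / 8 * (H^2 + hsum2 m)"
    unfolding e_def sum_alt_binom_div sum_alt_binom_div_square by (simp add: field_simps)
  finally have "pcong 3 (P * D) (P * (H / 2 + P / 8 * (H^2 + hsum2 m)))"
    by (rule pcong_scale_2)
  hence "pcong 3 (1 + P * D) (1 + P * (H / 2 + P / 8 * (H^2 + hsum2 m)))"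
    by (intro pcong_add) auto
  also have "pcong 3 \<dots> (1 + P * H / 2 + P^2 * H^2 / 8)"
    unfolding r(2) using r(1)
    by (intro pcongI[of _ _ _ "r / 8"]) (auto simp: power2_eq_square power3_eq_cube field_simps)
  finally show ?thesis unfolding eq .
qed

text \<open>By \<open>wallis_eq\<close>, \<open>4^m\<close> is the product of the quantities in
  \<open>wallis_m\<close> and \<open>central_alt_binom\<close>. These are truncations of
  \<open>exp(P*H/2)\<close> and \<open>exp(-P*H)\<close>, so the result truncates
  \<open>exp(-P*H/2)\<close>. Its square together with \<open>central_alt_binom\<close> is Morley's
  congruence.\<close>

lemma four_power_m: "pcong 3 (4^m) (1 - P * H / 2 + P^2 * H^2 / 8)"
proof -
  define B where "B = (of_nat ((2 * m) choose m) :: rat)"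
  have "B \<noteq> 0" by (simp add: B_def)
  hence "wallis m * P * B = 4^m" unfolding wallis_eq P_eq[symmetric] B_def by simp
  moreover have "(-1)^m * (-1)^m = (1::rat)" by (simp flip: power_add)
  ultimately have "4^m = ((-1)^m * P * wallis m) * ((-1)^m * B)" by (simp add: mult_ac)
  also have "(-1)^m * B = alt_binom (2 * m) m" by (simp add: alt_binom_def B_def)
  also have "pcong 3 (((-1)^m * P * wallis m) * alt_binom (2 * m) m)
      ((1 + P * H / 2 + P^2 * H^2 / 8) * (1 - P * H + P^2 * H^2 / 2))"
    by (intro pcong_mult wallis_m central_alt_binom) (simp_all add: alt_binom_def)
  also have "pcong 3 \<dots> (1 - P * H / 2 + P^2 * H^2 / 8)"
    by (intro pcongI[of _ _ _ "H^3 / 8 + P * H^4 / 16"])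
       (simp_all add: field_simps power2_eq_square power3_eq_cube eval_nat_numeral)
  finally show ?thesis .
qed

section \<open>The reduced summands modulo powers of p\<close>

lemma punit_binomial: "j \<le> n \<Longrightarrow> n < p \<Longrightarrow> punit (of_nat (n choose j))"
proof -
  assume j: "j \<le> n" "n < p"
  have "\<not> p dvd n choose j"
  proof
    assume "p dvd n choose j"
    hence "p dvd fact j * fact (n - j) * (n choose j)" by (rule dvd_mult)
    hence "p dvd fact n" using binomial_fact_lemma[OF j(1)] by simp
    thus False using prime j(2) by (simp add: prime_dvd_fact_iff)
  qed
  thus ?thesis using punit_of_int[of "int (n choose j)"] by simp
qed

lemma le_2m_less_p: "k \<le> 2 * m \<Longrightarrow> k < p"
  using p_eq by simp

lemma punit_of_nat_le: "0 < k \<Longrightarrow> k \<le> 2 * m \<Longrightarrow> punit (of_nat k)"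
  using punit_of_nat le_2m_less_p by blast

lemma punit_alt_binom: "j \<le> m \<Longrightarrow> punit (alt_binom m j)"
  unfolding alt_binom_def by (intro punit_mult punit_power punit_binomial le_2m_less_p) simp_all

lemma punit_mult_P_diff: "punit x \<Longrightarrow> r \<in> pint \<Longrightarrow> punit (P * r - x)"
  using punit_add[of "- x" r] by simp

lemma one_minus_square: "k \<in> {1..2*m} \<Longrightarrow> pcong 2 (1 - P^2 / (of_nat k)^2) 1"
  using punit_of_nat_le[of k] by (intro pcongI[of _ _ _ "- (1 / (of_nat k)^2)"]) auto

text \<open>Writing \<open>m\<close> as \<open>(P-1)/2\<close> exposes \<open>P\<close> in the
  ratio, which can then be compared with that of \<open>reduced_summand_Suc\<close>.\<close>

lemma alt_binom_m_Suc:
  "alt_binom m (Suc j) = alt_binom m j * ((2 * of_nat j + 1 - P) / (2 * (of_nat j + 1)))"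
proof -
  have "alt_binom m (Suc j) * (2 * (of_nat j + 1)) = alt_binom m j * (2 * of_nat j + 1 - P)"
    using alt_binom_Suc_right[of j m] by (simp add: P_eq algebra_simps)
  moreover have "2 * (of_nat j + 1 :: rat) \<noteq> 0"
    using of_nat_plus_one_nonzero[of j] by (simp only: mult_eq_0_iff) simp
  ultimately have "alt_binom m (Suc j) = alt_binom m j * (2 * of_nat j + 1 - P) / (2 * (of_nat j + 1))"
    by (metis eq_divide_imp)
  thus ?thesis by simp
qed

text \<open>Modulo \<open>p\<close> both sequences have the ratio
  \<open>(2*j+1) / (2*(j+1))\<close>. The first-order discrepancies of the ratios add up to the
  coefficient of \<open>P\<close>.\<close>

lemma reduced_summand_low:
  assumes "j \<le> m"
  shows "pcong 2 (reduced_summand p j) (alt_binom m j * (1 + P * (2 * osum j - hsum j / 2)))"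
  using assms
proof (induction j)
  case (Suc j)
  define J a e r s where "J = (of_nat j :: rat)" and "a = 2 * osum j - hsum j / 2" and "e = alt_binom m j"
    and "r = (P + 2 * J + 2) * (P + 2 * J + 1) / (4 * (J + 1) * (P + J + 1))"
    and "s = 1 - P^2 / (of_nat (Suc j))^2"
  have u: "punit (J + 1)" "punit (2 * J + 1)"
    unfolding J_def using Suc.prems by (auto intro: punit_Suc punit_odd)
  hence u3: "punit (P + J + 1)"
    using punit_add[of "J + 1" 1] by (simp add: add_ac)
  have J: "J \<in> pint" by (simp add: J_def)
  have a: "a \<in> pint" unfolding a_def using pint_osum[of j] pint_hsum[of j] Suc.prems by simp
  have e: "e \<in> pint" unfolding e_def using punit_alt_binom[of j] Suc.prems by (intro punit_pint) simp
  \<comment> \<open>\<open>d\<close> is the logarithmic derivative at \<open>P = 0\<close> of the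
    ratio \<open>r\<close> minus that of the ratio in \<open>alt_binom_m_Suc\<close>.\<close>
  define d where "d = 2 * (1 / (2 * J + 1)) - 1 / (J + 1) / 2"
  have d: "d \<in> pint" unfolding d_def by (intro pint_diff pint_mult pint_divide u) simp_all
  have r: "r \<in> pint" unfolding r_def by (intro pint_divide punit_mult u u3) (use J in simp_all)
  have s: "pcong 2 s 1" unfolding s_def using Suc.prems by (intro one_minus_square) simp
  have "pcong 2 (reduced_summand p (Suc j)) (e * (1 + P * a) * r * 1)"
  proof -
    have "reduced_summand p (Suc j) = reduced_summand p j * r * s" unfolding reduced_summand_Suc r_def s_def J_def ..
    moreover have ih: "pcong 2 (reduced_summand p j) (e * (1 + P * a))" using Suc by (simp add: e_def a_def)
    have "s \<in> pint" using pcong_pint[OF s] by simp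
    hence "pcong 2 (reduced_summand p j * r * s) (e * (1 + P * a) * r * 1)"
      using e a r by (intro pcong_mult[OF pcong_mult_right[OF ih r] s]) simp_all
    ultimately show ?thesis by simp
  qed
  also have "pcong 2 (r * 1) ((2 * J + 1 - P) / (2 * (J + 1)) * (1 + P * d))"
  proof (rule pcongI)
    define A B where "A = 2 * J + 1" and "B = J + 1"
    have u': "punit A" "punit B" "punit (P + B)" using u u3 by (simp_all add: A_def B_def add_ac)
    have JA: "P + 2 * J + 2 = P + 2 * B" "P + 2 * J + 1 = P + A" "2 * J + 1 - P = A - P" "P + J + 1 = P + B"
      by (simp_all add: A_def B_def)
    show "r * 1 = (2 * J + 1 - P) / (2 * (J + 1)) * (1 + P * d) +
        P^2 * ((A^2 - 2 * A * B + 4 * B^2 + P * (4 * B - A)) / (4 * A * B^2 * (P + B)))"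
      unfolding r_def d_def JA A_def[symmetric] B_def[symmetric]
      using u'[THEN punit_nonzero] by (simp add: divide_simps) (simp add: power2_eq_square algebra_simps)
    show "(A^2 - 2 * A * B + 4 * B^2 + P * (4 * B - A)) / (4 * A * B^2 * (P + B)) \<in> pint"
      using u' punit_pint[of A] punit_pint[of B] by simp
  qed
  hence "pcong 2 (e * (1 + P * a) * r * 1) (e * (1 + P * a) * ((2 * J + 1 - P) / (2 * (J + 1)) * (1 + P * d)))"
    using e a by (simp only: mult.assoc) (intro pcong_mult_left; simp)
  also have "\<dots> = alt_binom m (Suc j) * ((1 + P * a) * (1 + P * d))"
    unfolding alt_binom_m_Suc by (simp add: e_def J_def)
  also have "pcong 2 \<dots> (alt_binom m (Suc j) * (1 + P * (a + d)))"
  proof (rule pcong_mult_left)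
    show "pcong 2 ((1 + P * a) * (1 + P * d)) (1 + P * (a + d))"
      using a d by (intro pcongI[of _ _ _ "a * d"]) (auto simp: power2_eq_square algebra_simps)
    show "alt_binom m (Suc j) \<in> pint" using punit_alt_binom[of "Suc j"] Suc.prems by (intro punit_pint)
  qed
  also have "a + d = 2 * osum (Suc j) - hsum (Suc j) / 2"
  proof -
    have "(2 * c - h / 2) + (2 * x - y / 2) = 2 * (c + x) - (h + y) / 2" for c h x y :: rat
      by (simp add: field_simps)
    thus ?thesis unfolding a_def d_def J_def osum_simps hsum_simps .
  qed
  finally show ?case .
qed simp

definition asum :: rat where
  "asum = (\<Sum>k<m. (-1)^Suc k / (of_nat k + 1)^2)"

text \<open>For \<open>k < m\<close>, \<open>- P * rho k\<close> is the value modulo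
  \<open>p^2\<close> of the reduced summand at \<open>p - 1 - k\<close>, and
  \<open>rho k / 2\<close> is that of \<open>wallis k\<close> modulo \<open>p\<close>.\<close>

definition rho :: "nat \<Rightarrow> rat" where
  "rho k = 1 / ((of_nat k + 1) * alt_binom m (Suc k))"

lemma pint_asum [simp]: "asum \<in> pint"
  unfolding asum_def by (intro pint_sum pint_divide punit_power punit_Suc) simp_all

lemma pint_rho: "k < m \<Longrightarrow> rho k \<in> pint"
  unfolding rho_def by (intro pint_divide punit_mult punit_Suc punit_alt_binom) simp_all

lemma of_nat_diff_Suc: "i < n \<Longrightarrow> of_nat (n - Suc i) = (of_nat n - of_nat i - 1 :: rat)"
  by (simp add: of_nat_diff)

lemma prod_one_minus_square:
  "n \<le> 2 * m \<Longrightarrow> pcong 2 (\<Prod>i=1..n. 1 - P^2 / (of_nat i)^2) 1"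
proof (induction n)
  case (Suc n)
  have "pcong 2 ((\<Prod>i=1..n. 1 - P^2 / (of_nat i)^2) * (1 - P^2 / (of_nat (Suc n))^2)) (1 * 1)"
    using Suc by (intro pcong_mult one_minus_square pcong_pint[OF one_minus_square]) auto
  thus ?case by simp
qed simp

text \<open>To this precision the product is \<open>1 - P^2 * hsum2 m\<close>; the extra power of
  \<open>p\<close> compared with \<open>prod_one_minus_square\<close> comes from
  \<open>hsum2_m\<close>.\<close>

lemma prod_one_minus_square_m: "pcong 3 (\<Prod>i=1..m. 1 - P^2 / (of_nat i)^2) 1"
proof -
  have "pcong 3 (\<Prod>i=1..n. 1 - P^2 / (of_nat i)^2) (1 - P^2 * hsum2 n)" if "n \<le> m" for n
    using that
  proof (induction n)
    case (Suc n)
    define k where "k = (of_nat (Suc n) :: rat)"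
    have k: "punit k" unfolding k_def using Suc.prems by (intro punit_of_nat_le) auto
    have h: "hsum2 n \<in> pint" using Suc.prems by (intro pint_hsum2) simp
    have "pcong 3 ((\<Prod>i=1..n. 1 - P^2 / (of_nat i)^2) * (1 - P^2 / k^2)) ((1 - P^2 * hsum2 n) * (1 - P^2 / k^2))"
      using Suc k by (intro pcong_mult_right) auto
    also have "pcong 3 \<dots> (1 - P^2 * (hsum2 n + 1 / k^2))"
    proof (rule pcongI)
      show "(1 - P^2 * hsum2 n) * (1 - P^2 / k^2) = 1 - P^2 * (hsum2 n + 1 / k^2) + P^3 * (P * hsum2 n / k^2)"
        by (simp add: algebra_simps power2_eq_square power3_eq_cube)
    qed (use h k in simp)
    finally show ?case by (simp add: k_def add.commute)
  qed simp
  hence "pcong 3 (\<Prod>i=1..m. 1 - P^2 / (of_nat i)^2) (1 - P^2 * hsum2 m)" by simp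
  also obtain r where r: "r \<in> pint" "hsum2 m = 0 + P^1 * r" using hsum2_m by (rule pcongE)
  have "pcong 3 (1 - P^2 * hsum2 m) 1"
    unfolding r(2) using r(1) by (intro pcongI[of _ _ _ "- r"]) (auto simp: power2_eq_square power3_eq_cube)
  finally show ?thesis .
qed

text \<open>The precision \<open>p^3\<close> is needed because the term \<open>j = m\<close> has the
  denominator \<open>2*m + 1 = p\<close>. The upper binomial index is
  \<open>4*m + 1 = 2*p - 1\<close>, so the product form has factors \<open>1 - 2*P/i\<close>, a
  truncated \<open>exp(-2*P*H)\<close>.\<close>

lemma reduced_summand_mid: "pcong 3 (4^m * reduced_summand p m) ((-1)^m * (1 - 2 * P * H + 2 * P^2 * H^2))"
proof -
  define Q where "Q = (\<Prod>i=1..m. 1 - P^2 / (of_nat i)^2)"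
  have "4^m * reduced_summand p m = of_nat ((p + 2 * m) choose m) * Q"
    by (simp add: reduced_summand_def Q_def)
  also have "p + 2 * m = 4 * m + 1" by (simp add: p_eq)
  also have "of_nat ((4 * m + 1) choose m) = (-1)^m * alt_binom (4 * m + 1) m"
    by (simp add: alt_binom_def flip: power_add mult.assoc)
  also have "alt_binom (4 * m + 1) m = (\<Prod>i<m. 1 + P * (-2) / (of_nat i + 1))"
    unfolding alt_binom_eq_prod by (rule prod.cong) (simp_all add: P_eq minus_divide_left)
  finally have eq: "4^m * reduced_summand p m = (-1)^m * ((\<Prod>i<m. 1 + P * (-2) / (of_nat i + 1)) * Q)" by simp
  have 2: "-2 \<in> pint" using pint_minus[of 2] by simp
  have "pcong 3 ((\<Prod>i<m. 1 + P * (-2) / (of_nat i + 1)) * Q) ((1 + P * (-2) * H + (P * (-2))^2 * H^2 / 2) * 1)"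
    unfolding Q_def using 2
    by (intro pcong_mult prod_one_plus_m prod_one_minus_square_m pcong_pint[OF prod_one_minus_square_m]) auto
  also have "\<dots> = 1 - 2 * P * H + 2 * P^2 * H^2" by (simp add: power2_eq_square)
  finally show ?thesis unfolding eq by (rule pcong_mult_left) simp
qed

lemma four_power_m_mod_p: "pcong 1 (4^m) 1"
proof -
  have "pcong 1 (4^m) (1 - P * H / 2 + P^2 * H^2 / 8)"
    using four_power_m by (rule pcong_mono) simp
  also have "pcong 1 \<dots> 1"
    by (rule pcongI[of _ _ _ "- H / 2 + P * H^2 / 8"]) (simp_all add: power2_eq_square algebra_simps)
  finally show ?thesis .
qed

text \<open>The denominators are shifted by one against the numerators, which isolates the factor
  \<open>x\<close> of index 0; with \<open>x = 2*P\<close> it carries the power of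
  \<open>p\<close>.\<close>

lemma prod_shift: "(\<Prod>i<Suc n. (x + of_nat i) / (of_nat i + 1)) = x / (of_nat n + 1) * (\<Prod>i<n. 1 + x / (of_nat i + 1))" for x :: rat
proof (induction n)
  case (Suc n)
  define k where "k = (of_nat n + 1 :: rat)"
  have "k > 0" unfolding k_def using of_nat_0_le_iff[of n, where 'a=rat] by linarith
  hence k: "k \<noteq> 0" "k + 1 \<noteq> 0" by auto
  have "(\<Prod>i<Suc (Suc n). (x + of_nat i) / (of_nat i + 1)) = x / k * (\<Prod>i<n. 1 + x / (of_nat i + 1)) * ((x + k) / (k + 1))"
    unfolding prod.lessThan_Suc[of _ "Suc n"] Suc by (simp add: k_def add_ac)
  also have "\<dots> = x / (k + 1) * ((\<Prod>i<n. 1 + x / (of_nat i + 1)) * (1 + x / k))"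
    using k by (simp add: field_simps)
  finally show ?case by (simp add: k_def add_ac)
qed simp

text \<open>Start of the downward induction, at \<open>j = p - 1\<close>. One factor
  \<open>2*P\<close> of the binomial coefficient supplies \<open>p\<close>, and the remaining
  product, the factor \<open>Q\<close> and \<open>4^(2*m)\<close> are all 1 modulo
  \<open>p\<close>.\<close>

lemma reduced_summand_last: "pcong 2 (reduced_summand p (2 * m)) (- P * rho 0)"
proof -
  obtain n where n: "2 * m = Suc n" using m_ge by (cases "2 * m") auto
  define Q R where "Q = (\<Prod>i=1..2*m. 1 - P^2 / (of_nat i)^2)" and "R = (\<Prod>i<n. 1 + 2 * P / (of_nat i + 1))"
  have M: "of_nat n + 1 = 2 * (of_nat m :: rat)"
    using n by (metis of_nat_Suc of_nat_mult of_nat_numeral add.commute)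
  have um: "punit (of_nat m)" using m_ge by (intro punit_of_nat_le) auto
  have "p + 2 * (2 * m) = (4 * m + 1) + Suc n" using n by (simp add: p_eq)
  hence "of_nat ((p + 2 * (2 * m)) choose (2 * m)) = (\<Prod>i<Suc n. 1 + of_nat (4 * m + 1) / (of_nat i + 1) :: rat)"
    unfolding n by (simp only: binomial_eq_prod)
  also have "\<dots> = (\<Prod>i<Suc n. (2 * P + of_nat i) / (of_nat i + 1))"
    by (rule prod.cong) (simp_all add: P_eq add_divide_eq_iff field_simps)
  also have "\<dots> = P / of_nat m * R"
    unfolding prod_shift R_def M by simp
  finally have eq: "reduced_summand p (2 * m) = P * (R * Q / (4^(2*m) * of_nat m))"
    by (simp add: reduced_summand_def Q_def mult_ac)
  have "pcong 1 (\<Prod>i<k. 1 + 2 * P / (of_nat i + 1)) 1" if "k \<le> 2 * m" for k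
    using that
  proof (induction k)
    case (Suc k)
    have u: "punit (of_nat k + 1)" using Suc.prems by (intro punit_Suc) simp
    have "pcong 1 ((\<Prod>i<k. 1 + 2 * P / (of_nat i + 1)) * (1 + 2 * P / (of_nat k + 1))) (1 * 1)"
      using Suc u by (intro pcong_mult pcongI[of "1 + 2 * P / (of_nat k + 1)" _ _ "2 / (of_nat k + 1)"]) auto
    thus ?case by simp
  qed simp
  hence R: "pcong 1 R 1" unfolding R_def using n by simp
  have Q: "pcong 1 Q 1" unfolding Q_def
    using pcong_mono[OF prod_one_minus_square[OF order_refl], of 1] by simp
  have F: "pcong 1 (4^(2*m)) 1"
    unfolding mult_2 power_add using pcong_mult[OF four_power_m_mod_p four_power_m_mod_p] by simp
  have uF: "punit (4^(2*m))" by simp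
  have "pcong 1 (R * Q) (1 * 1)"
    by (intro pcong_mult R Q pcong_pint[OF Q]) simp_all
  also have "pcong 1 (1 * 1) (4^(2*m))" using pcong_sym[OF F] by simp
  finally have "pcong 1 (R * Q / (4^(2*m) * of_nat m)) (4^(2*m) / (4^(2*m) * of_nat m))"
    using um uF by (intro pcong_divide punit_mult)
  hence "pcong 2 (reduced_summand p (2 * m)) (P * (4^(2*m) / (4^(2*m) * of_nat m)))"
    unfolding eq by (rule pcong_scale_1)
  also have "P * (4^(2*m) / (4^(2*m) * of_nat m)) = - P * rho 0"
    by (simp add: rho_def alt_binom_def)
  finally show ?thesis .
qed

lemma rho_Suc: "rho (Suc k) * (2 * (of_nat k + 1) + 1 - P) = rho k * (2 * (of_nat k + 1))"
  if "Suc k < m"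
proof -
  define K e where "K = (of_nat k + 1 :: rat)" and "e = alt_binom m (Suc k)"
  have nz: "K \<noteq> 0" "K + 1 \<noteq> 0" "e \<noteq> 0"
    unfolding K_def e_def using that of_nat_plus_one_nonzero[of "Suc k"] by (auto simp: alt_binom_nonzero add_ac)
  have nz2: "2 * K + 1 - P \<noteq> 0"
  proof -
    have "2 * K + 1 - P = of_int (2 * int k + 3 - int p)" by (simp add: K_def)
    moreover have "2 * int k + 3 - int p \<noteq> 0" using that p_eq by presburger
    ultimately show ?thesis by (metis of_int_eq_0_iff)
  qed
  have "alt_binom m (Suc (Suc k)) = e * ((2 * K + 1 - P) / (2 * (K + 1)))"
    using alt_binom_m_Suc[of "Suc k"] by (simp add: K_def e_def add_ac)
  hence "rho (Suc k) = 1 / ((K + 1) * (e * ((2 * K + 1 - P) / (2 * (K + 1)))))"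
    by (simp add: rho_def K_def add_ac)
  also have "\<dots> = 2 / (e * (2 * K + 1 - P))"
  proof -
    have "1 / (a * (e * (d / (2 * a)))) = 2 / (e * d)" if "a \<noteq> 0" for a d :: rat using that by simp
    from this[OF nz(2)] show ?thesis .
  qed
  finally have "rho (Suc k) * (2 * K + 1 - P) = 2 / e"
  proof -
    assume "rho (Suc k) = 2 / (e * (2 * K + 1 - P))"
    moreover have "2 / (e * d) * d = 2 / e" if "d \<noteq> 0" for d :: rat using that by simp
    ultimately show ?thesis using nz2 by (simp only:)
  qed
  moreover have "rho k * (2 * K) = 2 / e" using nz by (simp add: rho_def flip: K_def e_def)
  ultimately show ?thesis unfolding K_def by (simp only:)
qed

text \<open>Induction downward from \<open>j = p - 1\<close>, dividing by the ratio of
  \<open>reduced_summand_Suc\<close>. Since the values already contain a factor \<open>P\<close>,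
  the ratio matters only modulo \<open>p\<close>; for \<open>k < m\<close> it is a unit.\<close>

lemma reduced_summand_high: "k < m \<Longrightarrow> pcong 2 (reduced_summand p (p - Suc k)) (- P * rho k)"
proof (induction k)
  case 0
  show ?case using reduced_summand_last by (simp add: p_eq)
next
  case (Suc k)
  \<comment> \<open>\<open>r\<close> and \<open>s\<close> are the factors of
    \<open>reduced_summand_Suc\<close> at the index \<open>P - K - 1\<close>.\<close>
  define K D D' r s where "K = (of_nat k + 1 :: rat)" and "D = reduced_summand p (p - Suc k)" and "D' = reduced_summand p (p - Suc (Suc k))"
    and "r = (3 * P - 2 * K) * (3 * P - 2 * K - 1) / (4 * (P - K) * (2 * P - K))"
    and "s = 1 - P^2 / (of_nat (p - Suc k))^2"
  have km: "Suc k < m" "Suc k < p" using Suc.prems p_eq by simp_all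
  have SS: "Suc (p - Suc (Suc k)) = p - Suc k" using km by simp
  have J: "of_nat (p - Suc (Suc k)) = P - K - 1"
    using km by (simp add: K_def of_nat_diff)
  have uK: "punit K" unfolding K_def using km by (intro punit_Suc) simp
  have "punit (2 * K + 1)" using punit_odd[OF km(1)] by (simp add: K_def add_ac)
  note uK = uK this punit_pint[OF uK]
  have u: "punit (P - K)" "punit (2 * P - K)" "punit (3 * P - 2 * K)" "punit (3 * P - 2 * K - 1)"
    using punit_mult_P_diff[of K 1] punit_mult_P_diff[of K 2] punit_mult_P_diff[of "2 * K" 3] punit_mult_P_diff[of "2 * K + 1" 3] uK
    by (simp_all add: mult.commute diff_diff_eq)
  have s: "pcong 2 s 1" unfolding s_def using km p_eq by (intro one_minus_square) auto
  have us: "punit s" using pcong_punit[of 1 s 1] s by (simp add: numeral_2_eq_2)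
  have ur: "punit r" unfolding r_def using u by (intro punit_divide punit_mult) simp_all
  have rec: "D = D' * r * s"
    unfolding D_def D'_def SS[symmetric] reduced_summand_Suc J s_def r_def
    by (simp add: SS J algebra_simps)
  have D': "D' = D / (r * s)" using rec punit_nonzero[OF us] punit_nonzero[OF ur] by simp
  have rk: "rho k \<in> pint" "rho (Suc k) \<in> pint" using km by (auto intro: pint_rho)
  have r: "pcong 1 r ((2 * K + 1) / (2 * K))"
  proof -
    have "pcong 1 (((3 * P - 2 * K) * (3 * P - 2 * K - 1)) * (2 * K)) ((2 * K + 1) * (4 * (P - K) * (2 * P - K)))"
      by (rule pcongI[of _ _ _ "2 * K * (9 * P - 12 * K - 3) - (2 * K + 1) * (8 * P - 12 * K)"])
         (use uK in \<open>simp_all add: algebra_simps\<close>)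
    hence "pcong 1 ((((3 * P - 2 * K) * (3 * P - 2 * K - 1)) * (2 * K)) / ((4 * (P - K) * (2 * P - K)) * (2 * K)))
        (((2 * K + 1) * (4 * (P - K) * (2 * P - K))) / ((4 * (P - K) * (2 * P - K)) * (2 * K)))"
      using u uK by (intro pcong_divide punit_mult) simp_all
    thus ?thesis unfolding r_def
      using punit_nonzero[OF uK(1)] punit_nonzero[OF u(1)] punit_nonzero[OF u(2)] by simp
  qed
  have rs: "pcong 1 (r * s) ((2 * K + 1) / (2 * K) * 1)"
    using r pcong_mono[OF s, of 1] uK us by (intro pcong_mult punit_pint[OF us]) auto
  have "pcong 1 (rho k) (rho (Suc k) * (r * s))"
  proof -
    have "pcong 1 (rho (Suc k) * (r * s)) (rho (Suc k) * ((2 * K + 1) / (2 * K)))"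
      using pcong_mult_left[OF rs rk(2)] by simp
    also have "pcong 1 (rho (Suc k) * ((2 * K + 1) / (2 * K))) (rho k)"
    proof (rule pcongI)
      have "rho k = rho (Suc k) * (2 * K + 1 - P) / (2 * K)"
        using rho_Suc[OF km(1)] punit_nonzero[OF uK(1)] by (simp add: K_def)
      thus "rho (Suc k) * ((2 * K + 1) / (2 * K)) = rho k + P^1 * (rho (Suc k) / (2 * K))"
        by (simp add: diff_divide_distrib add_divide_distrib algebra_simps)
    qed (use rk uK in simp)
    finally show ?thesis by (rule pcong_sym)
  qed
  hence "pcong 2 (P * rho k) (P * (rho (Suc k) * (r * s)))"
    by (rule pcong_scale_1)
  hence "pcong 2 (- P * rho k) (- P * (rho (Suc k) * (r * s)))"
    using pcong_minus by fastforce
  hence "pcong 2 D (- P * (rho (Suc k) * (r * s)))"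
    using Suc.IH km unfolding D_def by (auto intro: pcong_trans)
  hence "pcong 2 (D / (r * s)) (- P * (rho (Suc k) * (r * s)) / (r * s))"
    using ur us by (intro pcong_divide punit_mult)
  also have "- P * (rho (Suc k) * (r * s)) / (r * s) = - P * rho (Suc k)"
    using punit_nonzero[OF us] punit_nonzero[OF ur] by simp
  finally show ?case unfolding D'[symmetric] D'_def .
qed

section \<open>The Euler number modulo p\<close>

lemma fermat: "0 < a \<Longrightarrow> a \<le> 2 * m \<Longrightarrow> pcong 1 ((of_nat a)^(p - 3)) (1 / (of_nat a)^2)"
proof -
  assume a: "0 < a" "a \<le> 2 * m"
  hence u: "punit (of_nat a)" by (rule punit_of_nat_le)
  have "\<not> p dvd a" using a p_eq by (auto dest: dvd_imp_le)
  hence "[a ^ (p - 1) = 1] (mod p)" using prime by (intro fermat_theorem)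
  hence "p dvd a ^ (p - 1) - 1" by (rule cong_to_1_nat)
  then obtain c where "a ^ (p - 1) - 1 = p * c" by (elim dvdE)
  moreover have "a ^ (p - 1) \<ge> 1" using a by simp
  ultimately have "a ^ (p - 1) = 1 + p * c" by simp
  hence "(of_nat a :: rat) ^ (p - 1) = 1 + P * of_nat c"
    by (metis of_nat_1 of_nat_add of_nat_mult of_nat_power)
  moreover have "p - 1 = (p - 3) + 2" using p_gt_3 by simp
  ultimately have "(of_nat a)^(p - 3) * (of_nat a)^2 = 1 + P * of_nat c"
    by (simp only: power_add)
  hence "(of_nat a :: rat)^(p - 3) = (1 + P * of_nat c) / (of_nat a)^2"
    using a by (simp add: eq_divide_eq)
  also have "\<dots> = 1 / (of_nat a)^2 + P^1 * (of_nat c / (of_nat a)^2)"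
    by (simp add: add_divide_distrib)
  finally show ?thesis by (rule pcongI) (use u in simp)
qed

lemma pint_euler_number [simp]: "euler_number n \<in> pint"
  using euler_number_Ints[of n] by (auto elim!: Ints_cases)

lemma euler_poly_P: "pcong 1 (euler_poly n P) (euler_number n)"
proof -
  have "pcong 1 (of_nat (n choose i) * euler_number i * P ^ (n - i)) 0" if "i < n" for i
  proof (rule pcongI)
    have "n - i = Suc (n - i - 1)" using that by simp
    thus "of_nat (n choose i) * euler_number i * P ^ (n - i) =
        0 + P^1 * (of_nat (n choose i) * euler_number i * P ^ (n - i - 1))"
      by (metis add_0 mult.left_commute power_Suc power_one_right)
  qed simp
  hence "pcong 1 (\<Sum>i<n. of_nat (n choose i) * euler_number i * P ^ (n - i)) (\<Sum>i<n. 0)"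
    by (intro pcong_sum) auto
  from pcong_add[OF this pcong_refl[of 1 "euler_number n"]] show ?thesis
    by (simp add: euler_poly_eq lessThan_Suc_atMost[symmetric])
qed

text \<open>\<open>alternating_power_sum\<close> ends at the argument \<open>p\<close>, where
  \<open>euler_poly_P\<close> gives the Euler number. Fermat's theorem replaces each power with
  exponent \<open>p - 3\<close> by an inverse square; the constants \<open>2\<close> and
  \<open>1/4\<close> combine to \<open>1/2\<close>.\<close>

lemma euler_number_pcong: "pcong 1 (euler_number (p - 3)) ((-1)^m * asum / 2)"
proof -
  have n: "even (p - 3)" "p - 3 \<noteq> 0" using p_eq m_ge by auto
  have "pcong 1 (\<Sum>k<m. (-1)^Suc k * (2 * (2 * (of_nat k + 1))^(p-3)))
      (\<Sum>k<m. (-1)^Suc k * (2 * (1 / (2 * (of_nat k + 1))^2)))"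
  proof (rule pcong_sum)
    fix k assume "k \<in> {..<m}"
    hence "pcong 1 ((2 * (of_nat k + 1))^(p-3)) (1 / (2 * (of_nat k + 1))^2)"
      using fermat[of "2 * (k + 1)"] by (simp add: add.commute)
    thus "pcong 1 ((-1)^Suc k * (2 * (2 * (of_nat k + 1))^(p-3))) ((-1)^Suc k * (2 * (1 / (2 * (of_nat k + 1))^2)))"
      by (intro pcong_mult_left) simp_all
  qed
  also have "(\<Sum>k<m. (-1)^Suc k * (2 * (1 / (2 * (of_nat k + 1) :: rat)^2))) = asum / 2"
    unfolding asum_def sum_divide_distrib power_mult_distrib by (simp add: mult.commute)
  finally have "pcong 1 ((-1)^m * euler_poly (p - 3) P) (asum / 2)"
    unfolding alternating_power_sum[OF n] P_eq[symmetric] .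
  hence "pcong 1 ((-1)^m * ((-1)^m * euler_poly (p - 3) P)) ((-1)^m * (asum / 2))"
    by (rule pcong_mult_left) simp
  moreover have "(-1)^m * ((-1)^m * euler_poly (p - 3) P) = euler_poly (p - 3) P"
    by (simp flip: power_add mult.assoc)
  ultimately show ?thesis using euler_poly_P[of "p - 3"] by (auto intro: pcong_trans pcong_sym)
qed

section \<open>Sums over the lower and upper ranges\<close>

lemma sum_rho_div: "pcong 1 (\<Sum>k<m. rho k / (of_nat k + 1)) (2 * asum)"
proof -
  have "(\<Sum>k<m. rho k / (of_nat k + 1)) = (\<Sum>k<m. 1 / ((of_nat k + 1)^2 * alt_binom m (Suc k)))"
    by (simp add: rho_def power2_eq_square mult_ac)
  also have "\<dots> = (\<Sum>k<m. 1 / (of_nat k + 1)^2 + 2 * ((-1)^Suc k / (of_nat k + 1)^2))"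
    unfolding sum_inverse_square_alt_binom by (simp add: diff_divide_distrib)
  also have "\<dots> = hsum2 m + 2 * asum"
    by (simp only: hsum2_def asum_def sum.distrib sum_distrib_left)
  also have "pcong 1 \<dots> (0 + 2 * asum)" by (intro pcong_add hsum2_m) simp
  finally show ?thesis by simp
qed

text \<open>Absorption rewrites \<open>rho k\<close> as a constant over
  \<open>alt_binom (m-1) k\<close>, whose reflection has the sign \<open>(-1)^(m-1)\<close>.\<close>

lemma rho_reflect: "k < m \<Longrightarrow> rho (m - Suc k) = - ((-1)^m * rho k)"
proof -
  assume k: "k < m"
  obtain n where n: "m = Suc n" using m_ge by (cases m) auto
  have r: "rho i = 1 / (- (of_nat n + 1) * alt_binom n i)" for i
  proof -
    have "(of_nat i + 1) * alt_binom m (Suc i) = - (of_nat n + 1) * alt_binom n i"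
      unfolding n by (rule alt_binom_absorb)
    thus ?thesis unfolding rho_def by (simp only:)
  qed
  have refl: "alt_binom n (n - k) = (-1)^n * alt_binom n k" using k n by (intro alt_binom_reflect) simp
  have sgn: "1 / (c * (t * x)) = t * (1 / (c * x))" if "t = 1 \<or> t = -1" for c t x :: rat
    using that by auto
  have "(-1)^n = (1::rat) \<or> (-1)^n = (-1::rat)" by (cases "even n") auto
  hence "rho (n - k) = (-1)^n * rho k" unfolding r refl by (rule sgn)
  moreover have "m - Suc k = n - k" "(-1)^m = - ((-1)^n :: rat)" by (simp_all add: n)
  ultimately show ?thesis by (simp only: mult_minus_left minus_minus)
qed

lemma punit_P_diff: "i < m \<Longrightarrow> punit (P - 2 * (of_nat i + 1))"
  using punit_mult_P_diff[OF punit_mult[OF punit_2 punit_Suc[of i]], of 1] by simp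

lemma inverse_P_diff:
  assumes "i < m" "x \<in> pint"
  shows "pcong 1 (x / (P - 2 * (of_nat i + 1))) (- (x / (of_nat i + 1)) / 2)"
proof -
  define k where "k = (of_nat i + 1 :: rat)"
  have k: "punit k" "punit (P - 2 * k)" unfolding k_def using assms punit_Suc[of i] punit_P_diff by auto
  show ?thesis unfolding k_def[symmetric]
  proof (rule pcongI)
    have "1 / (P - 2 * k) = - (1 / k) / 2 + P * (1 / (2 * k * (P - 2 * k)))"
      using k[THEN punit_nonzero] by (simp add: field_simps)
    hence "x * (1 / (P - 2 * k)) = x * (- (1 / k) / 2 + P * (1 / (2 * k * (P - 2 * k))))" by (simp only:)
    thus "x / (P - 2 * k) = - (x / k) / 2 + P^1 * (x / (2 * k * (P - 2 * k)))"
      by (simp add: right_diff_distrib distrib_left mult_ac)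
  qed (use k assms in simp)
qed

lemma odd_reflect: "i < m \<Longrightarrow> 2 * of_nat (m - Suc i) + 1 = P - 2 * (of_nat i + 1)"
  by (simp add: of_nat_diff_Suc P_eq algebra_simps)

text \<open>Reflection replaces \<open>2*k+1\<close> by \<open>P - 2*(k+1)\<close>, which is
  \<open>-2*(k+1)\<close> modulo \<open>p\<close>; this reduces the sum to
  \<open>sum_rho_div\<close>.\<close>

lemma sum_rho_odd: "pcong 1 (\<Sum>k<m. rho k / (2 * of_nat k + 1)) ((-1)^m * asum)"
proof -
  have "(\<Sum>k<m. rho k / (2 * of_nat k + 1)) = (\<Sum>k<m. - ((-1)^m * rho k) / (P - 2 * (of_nat k + 1)))"
    by (subst sum_reflect_m, rule sum.cong) (simp_all only: lessThan_iff odd_reflect rho_reflect)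
  also have "pcong 1 \<dots> (\<Sum>k<m. - (- ((-1)^m * rho k) / (of_nat k + 1)) / 2)"
    by (intro pcong_sum inverse_P_diff) (auto simp: pint_rho)
  also have "\<dots> = (-1)^m / 2 * (\<Sum>k<m. rho k / (of_nat k + 1))"
    unfolding sum_distrib_left by (rule sum.cong) simp_all
  also have "pcong 1 \<dots> ((-1)^m / 2 * (2 * asum))"
    by (intro pcong_mult_left sum_rho_div) simp
  finally show ?thesis by simp
qed

text \<open>The denominator at \<open>p - 1 - k\<close> is \<open>2*P - (2*k+1)\<close>; its sign
  modulo \<open>p\<close> cancels the minus sign of \<open>reduced_summand_high\<close>.\<close>

lemma sum_reduced_summand_high:
  "pcong 2 (\<Sum>k<m. reduced_summand p (p - Suc k) / (2 * of_nat (p - Suc k) + 1)) (P * ((-1)^m * asum))"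
proof -
  have "pcong 2 (reduced_summand p (p - Suc k) / (2 * of_nat (p - Suc k) + 1)) (P * (rho k / (2 * of_nat k + 1)))"
    if k: "k < m" for k
  proof -
    define c d where "c = (2 * of_nat k + 1 :: rat)" and "d = P * 2 - c"
    have u: "punit c" "punit d"
      unfolding c_def d_def using punit_odd[OF k] punit_mult_P_diff[of "2 * of_nat k + 1" 2] by simp_all
    have "k < p" using k p_eq by simp
    hence den: "2 * of_nat (p - Suc k) + 1 = d" by (simp add: of_nat_diff_Suc d_def c_def)
    have "pcong 2 (reduced_summand p (p - Suc k) / d) (- P * rho k / d)"
      by (intro pcong_divide reduced_summand_high k u)
    also have "- P * rho k / d = P * (- rho k / d)" by simp
    also have "pcong 2 \<dots> (P * (rho k / c))"
    proof (rule pcong_scale_1, rule pcongI)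
      have "- 1 / d = 1 / c - P * (2 / (c * d))"
        using u[THEN punit_nonzero] by (simp add: d_def field_simps)
      hence "rho k * (- 1 / d) = rho k * (1 / c - P * (2 / (c * d)))" by (simp only:)
      thus "- rho k / d = rho k / c + P^1 * (- 2 * rho k / (c * d))"
        by (simp add: right_diff_distrib mult_ac)
    qed (use u k in \<open>simp add: pint_rho\<close>)
    finally show ?thesis unfolding den c_def .
  qed
  hence "pcong 2 (\<Sum>k<m. reduced_summand p (p - Suc k) / (2 * of_nat (p - Suc k) + 1)) (P * (\<Sum>k<m. rho k / (2 * of_nat k + 1)))"
    unfolding sum_distrib_left by (intro pcong_sum) auto
  also have "pcong 2 \<dots> (P * ((-1)^m * asum))"
    by (intro pcong_scale_1 sum_rho_odd)
  finally show ?thesis .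
qed

text \<open>Modulo \<open>p\<close> the recurrences \<open>wallis_Suc\<close> and
  \<open>rho_Suc\<close> coincide, and the initial values agree because \<open>2*m\<close> is
  \<open>-1\<close> modulo \<open>p\<close>.\<close>

lemma wallis_pcong: "j < m \<Longrightarrow> pcong 1 (wallis j) (rho j / 2)"
proof (induction j)
  case 0
  have u: "punit (of_nat m)" using m_ge by (intro punit_of_nat_le) auto
  show ?case
  proof (rule pcongI)
    show "wallis 0 = rho 0 / 2 + P^1 * (1 / (2 * of_nat m))"
      using punit_nonzero[OF u] by (simp add: rho_def alt_binom_def P_eq field_simps)
  qed (use u in simp)
next
  case (Suc j)
  define K where "K = (of_nat j + 1 :: rat)"
  have u: "punit (2 * K + 1)" using punit_odd[OF Suc.prems] by (simp add: K_def add_ac)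
  have K: "K \<in> pint" by (simp add: K_def)
  have "pcong 1 ((2 * K + 1) * wallis (Suc j)) ((2 * K) * (rho j / 2))"
  proof -
    have "(2 * K + 1) * wallis (Suc j) = (2 * K) * wallis j"
      using wallis_Suc[of j] by (simp add: K_def algebra_simps)
    thus ?thesis using Suc K by (simp only:) (intro pcong_mult_left; simp)
  qed
  also have "(2 * K) * (rho j / 2) = (2 * K + 1 - P) * (rho (Suc j) / 2)"
    using rho_Suc[OF Suc.prems] by (simp add: K_def mult.commute)
  also have "pcong 1 \<dots> ((2 * K + 1) * (rho (Suc j) / 2))"
    by (rule pcongI[of _ _ _ "- rho (Suc j) / 2"])
       (use Suc.prems in \<open>simp_all add: pint_rho diff_divide_distrib left_diff_distrib\<close>)
  finally show ?case by (rule pcong_cancel) (rule u)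
qed

lemma osum_m: "pcong 1 (osum m) (- H / 2)"
proof -
  have "osum m = (\<Sum>i<m. 1 / (P - 2 * (of_nat i + 1)))"
    unfolding osum_def by (subst sum_reflect_m, rule sum.cong) (simp_all only: lessThan_iff odd_reflect)
  also have "pcong 1 \<dots> (\<Sum>i<m. - (1 / (of_nat i + 1)) / 2)"
    by (intro pcong_sum inverse_P_diff) auto
  also have "\<dots> = - H / 2"
    by (simp add: hsum_def sum_negf sum_divide_distrib)
  finally show ?thesis .
qed

text \<open>The correction coefficient of \<open>reduced_summand_low\<close> at a reflected index.
  Modulo \<open>p\<close>, reflection exchanges odd denominators \<open>2*n+1\<close> with even
  ones, so the roles of \<open>osum\<close> and \<open>hsum\<close> are swapped; the constant comes
  from \<open>osum_m\<close>.\<close>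

lemma delta_reflect:
  "j \<le> m \<Longrightarrow> pcong 1 (2 * osum (m - j) - hsum (m - j) / 2) (- 3 * H / 2 + hsum j - osum j)"
proof (induction j)
  case 0
  have "pcong 1 (2 * osum m - H / 2) (2 * (- H / 2) - H / 2)"
    by (intro pcong_diff pcong_mult_left osum_m) simp_all
  thus ?case by simp
next
  case (Suc j)
  hence j: "j < m" by simp
  define n where "n = m - Suc j"
  have n: "m - j = Suc n" using j by (simp add: n_def)
  have o: "2 * of_nat n + 1 = P - 2 * (of_nat j + 1)" unfolding n_def using j by (rule odd_reflect)
  have h: "2 * (of_nat n + 1) = P * 1 - (2 * of_nat j + 1)" using o by (simp add: algebra_simps)
  have u: "punit (2 * of_nat j + 1)" using punit_odd[OF j] .
  hence u': "punit (P * 1 - (2 * of_nat j + 1))" by (rule punit_mult_P_diff) simp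
  have "2 * osum n - hsum n / 2 = (2 * osum (Suc n) - hsum (Suc n) / 2) - 2 * (1 / (2 * of_nat n + 1)) + 1 / (2 * (of_nat n + 1))"
  proof -
    have "2 * c - h / 2 = (2 * (c + x) - (h + y) / 2) - 2 * x + y / 2" for c h x y :: rat
      by (simp add: field_simps)
    from this[of "osum n" "hsum n" "1 / (2 * of_nat n + 1)" "1 / (of_nat n + 1)"]
    show ?thesis by simp
  qed
  also have "\<dots> = (2 * osum (m - j) - hsum (m - j) / 2) - 2 * (1 / (P - 2 * (of_nat j + 1))) + 1 / (P * 1 - (2 * of_nat j + 1))"
    unfolding n o h ..
  also have "pcong 1 \<dots> ((- 3 * H / 2 + hsum j - osum j) - 2 * (- (1 / (of_nat j + 1)) / 2) + - 1 / (2 * of_nat j + 1))"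
  proof -
    have "1 / (P - c) = - 1 / c + P * (1 / (c * (P - c)))" if "c \<noteq> 0" "P - c \<noteq> 0" for c
      using that by (simp add: field_simps)
    from this[of "2 * of_nat j + 1"] have
      "1 / (P * 1 - (2 * of_nat j + 1)) = - 1 / (2 * of_nat j + 1) + P^1 * (1 / ((2 * of_nat j + 1) * (P * 1 - (2 * of_nat j + 1))))"
      using punit_nonzero[OF u] punit_nonzero[OF u'] by simp
    hence a: "pcong 1 (1 / (P * 1 - (2 * of_nat j + 1))) (- 1 / (2 * of_nat j + 1))"
      by (rule pcongI) (intro pint_divide punit_mult u u' pint_numeral)
    have b: "pcong 1 (1 / (P - 2 * (of_nat j + 1))) (- (1 / (of_nat j + 1)) / 2)"
      using j by (intro inverse_P_diff) simp_all
    have c: "pcong 1 (2 * osum (m - j) - hsum (m - j) / 2) (- 3 * H / 2 + hsum j - osum j)"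
      using Suc by simp
    show ?thesis
      by (rule pcong_add[OF pcong_diff[OF c pcong_mult_left[OF b]] a]) simp
  qed
  also have "\<dots> = - 3 * H / 2 + hsum (Suc j) - osum (Suc j)"
  proof -
    have "(a + h - c) - 2 * (- x / 2) + - 1 / d = a + (h + x) - (c + 1 / d)" for a h c x d :: rat
      by simp
    thus ?thesis unfolding hsum_simps osum_simps .
  qed
  finally show ?case unfolding n_def .
qed

text \<open>Reflection turns \<open>1/(2*j+1)\<close> into a multiple of \<open>1/(i+1)\<close>
  modulo \<open>p\<close> and the correction into \<open>g\<close>. The three parts of
  \<open>g\<close> then meet the closed forms for the constant, \<open>hsum\<close> and
  \<open>osum\<close>; the last one yields \<open>asum\<close> through
  \<open>wallis_pcong\<close>.\<close>

lemma sum_alt_binom_delta: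
  "pcong 1 (\<Sum>j<m. alt_binom m j * (2 * osum j - hsum j / 2) / (2 * of_nat j + 1))
     (- ((-1)^m) / 2 * (3 * H^2 / 2 + asum))"
proof -
  define e where "e i = alt_binom m (Suc i)" for i
  define g where "g i = - 3 * H / 2 + hsum (Suc i) - osum (Suc i)" for i
  have e: "e i \<in> pint" for i by (simp add: e_def alt_binom_def)
  have g: "g i \<in> pint" if "i < m" for i
  proof -
    have "hsum (Suc i) \<in> pint" "osum (Suc i) \<in> pint" using that by (auto intro!: pint_hsum pint_osum simp del: hsum_simps osum_simps)
    thus ?thesis unfolding g_def using pint_minus[of 3] by (intro pint_diff pint_add pint_divide pint_mult) auto
  qed
  have "(\<Sum>j<m. alt_binom m j * (2 * osum j - hsum j / 2) / (2 * of_nat j + 1)) =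
      (\<Sum>i<m. alt_binom m (m - Suc i) * (2 * osum (m - Suc i) - hsum (m - Suc i) / 2) / (2 * of_nat (m - Suc i) + 1))"
    by (rule sum_reflect_m)
  also have "\<dots> = (\<Sum>i<m. (-1)^m * e i * (2 * osum (m - Suc i) - hsum (m - Suc i) / 2) / (P - 2 * (of_nat i + 1)))"
    by (rule sum.cong) (simp_all only: lessThan_iff odd_reflect alt_binom_reflect[OF Suc_leI] e_def)
  also have "pcong 1 \<dots> (\<Sum>i<m. - (((-1)^m * e i * g i) / (of_nat i + 1)) / 2)"
  proof (rule pcong_sum)
    fix i assume "i \<in> {..<m}"
    hence i: "i < m" by simp
    have "pcong 1 ((-1)^m * e i * (2 * osum (m - Suc i) - hsum (m - Suc i) / 2) / (P - 2 * (of_nat i + 1)))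
        ((-1)^m * e i * g i / (P - 2 * (of_nat i + 1)))"
      unfolding g_def using i e delta_reflect[of "Suc i"]
      by (intro pcong_divide pcong_mult_left punit_P_diff) auto
    also have "pcong 1 \<dots> (- (((-1)^m * e i * g i) / (of_nat i + 1)) / 2)"
      using i e g[OF i] by (intro inverse_P_diff) auto
    finally show "pcong 1 ((-1)^m * e i * (2 * osum (m - Suc i) - hsum (m - Suc i) / 2) / (P - 2 * (of_nat i + 1)))
        (- (((-1)^m * e i * g i) / (of_nat i + 1)) / 2)" .
  qed
  also have "\<dots> = - ((-1)^m) / 2 * (\<Sum>i<m. e i * g i / (of_nat i + 1))"
    unfolding sum_distrib_left by (rule sum.cong) (simp_all add: mult_ac)
  also have "(\<Sum>i<m. e i * g i / (of_nat i + 1)) =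
     - 3 * H / 2 * (\<Sum>i<m. e i / (of_nat i + 1)) + (\<Sum>i<m. e i * hsum (Suc i) / (of_nat i + 1)) - (\<Sum>i<m. e i * osum (Suc i) / (of_nat i + 1))"
  proof -
    have expand: "x * (a + h - c) / d = a * (x / d) + x * h / d - x * c / d" for x a h c d :: rat
      by (simp add: algebra_simps add_divide_distrib diff_divide_distrib)
    show ?thesis
      unfolding sum_distrib_left sum.distrib[symmetric] sum_subtractf[symmetric] g_def by (intro sum.cong refl expand)
  qed
  also have "\<dots> = 3 * H^2 / 2 - hsum2 m + (\<Sum>j<m. wallis j / (of_nat j + 1))"
    unfolding e_def sum_alt_binom_div sum_alt_binom_hsum sum_alt_binom_osum by (simp add: power2_eq_square)
  also have "pcong 1 (- ((-1)^m) / 2 * \<dots>) (- ((-1)^m) / 2 * (3 * H^2 / 2 - 0 + asum))"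
  proof (intro pcong_mult_left pcong_add pcong_diff hsum2_m)
    have "pcong 1 (\<Sum>j<m. wallis j / (of_nat j + 1)) (\<Sum>j<m. (rho j / 2) / (of_nat j + 1))"
      by (intro pcong_sum pcong_divide wallis_pcong punit_Suc) auto
    also have "\<dots> = (\<Sum>j<m. rho j / (of_nat j + 1)) / 2"
      by (simp add: sum_divide_distrib mult.commute)
    also have "pcong 1 \<dots> (2 * asum / 2)" by (intro pcong_divide sum_rho_div) simp
    finally show "pcong 1 (\<Sum>j<m. wallis j / (of_nat j + 1)) asum" by simp
  qed simp_all
  finally show ?thesis by simp
qed

lemma sum_reduced_summand_low:
  "pcong 2 (\<Sum>j<m. reduced_summand p j / (2 * of_nat j + 1))
     ((\<Sum>j<m. alt_binom m j / (2 * of_nat j + 1)) + P * (- ((-1)^m) / 2 * (3 * H^2 / 2 + asum)))"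
proof -
  have "pcong 2 (\<Sum>j<m. reduced_summand p j / (2 * of_nat j + 1))
      (\<Sum>j<m. alt_binom m j * (1 + P * (2 * osum j - hsum j / 2)) / (2 * of_nat j + 1))"
    by (intro pcong_sum pcong_divide reduced_summand_low punit_odd) auto
  also have "\<dots> = (\<Sum>j<m. alt_binom m j / (2 * of_nat j + 1)) +
      P * (\<Sum>j<m. alt_binom m j * (2 * osum j - hsum j / 2) / (2 * of_nat j + 1))"
    unfolding sum_distrib_left sum.distrib[symmetric]
    by (rule sum.cong) (simp_all only: distrib_left add_divide_distrib mult_1_right times_divide_eq_right mult_ac)
  also have "pcong 2 \<dots> ((\<Sum>j<m. alt_binom m j / (2 * of_nat j + 1)) + P * (- ((-1)^m) / 2 * (3 * H^2 / 2 + asum)))"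
    by (intro pcong_add pcong_scale_1 sum_alt_binom_delta) simp
  finally show ?thesis .
qed

section \<open>Combining the three ranges\<close>

lemma sum_reduced_summand:
  "pcong 3 (P * (\<Sum>j<p. reduced_summand p j / (2 * of_nat j + 1))) (4^(2*m) * ((-1)^m * (1 + P^2 * asum / 2)))"
proof -
  define s where "s = ((-1)^m :: rat)"
  have s: "s \<in> pint" "s * s = 1" unfolding s_def by (simp_all flip: power_add)
  define f where "f j = reduced_summand p j / (2 * of_nat j + 1)" for j
  define g where "g = 1 - P * H / 2 + P^2 * H^2 / 8"
  have gp: "g \<in> pint" by (simp add: g_def)
  \<comment> \<open>Up to the sign \<open>s\<close>, \<open>y\<close> collects the lower and upper
    ranges; the term \<open>- s\<close> in \<open>low\<close> cancels the leading 1 of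
    \<open>W\<close>.\<close>
  define y where "y = P * H / 2 - 5 * P^2 * H^2 / 8 + P^2 * asum / 2"
  have yp: "y \<in> pint" by (simp add: y_def)
  have "(\<Sum>j<p. f j) = (\<Sum>j<m + Suc m. f j)" by (simp add: p_eq mult_2)
  also have "\<dots> = (\<Sum>j<m. f j) + (\<Sum>i<Suc m. f (m + i))" by (rule sum_lessThan_add)
  also have "(\<Sum>i<Suc m. f (m + i)) = f m + (\<Sum>i<m. f (m + Suc i))"
    by (subst sum.lessThan_Suc_shift) simp
  also have "(\<Sum>i<m. f (m + Suc i)) = (\<Sum>k<m. f (p - Suc k))"
    by (subst sum_reflect_m, rule sum.cong) (auto simp: p_eq intro!: arg_cong[of _ _ f])
  \<comment> \<open>At \<open>j = m\<close> the denominator \<open>2*m + 1\<close> is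
    \<open>P\<close>, so the factor \<open>P\<close> leaves the bare middle summand.\<close>
  finally have split: "P * (\<Sum>j<p. f j) = P * (\<Sum>j<m. f j) + (reduced_summand p m + P * (\<Sum>k<m. f (p - Suc k)))"
    by (simp add: distrib_left f_def P_eq[symmetric])
  have L: "P * (\<Sum>j<m. alt_binom m j / (2 * of_nat j + 1)) = P * wallis m - s"
    by (simp add: wallis_def lessThan_Suc_atMost[symmetric] alt_binom_self s_def distrib_left P_eq[symmetric])
  have low: "pcong 3 (P * (\<Sum>j<m. f j)) (P * wallis m - s + P * (P * (- s / 2 * (3 * H^2 / 2 + asum))))"
    using pcong_scale_2[OF sum_reduced_summand_low] unfolding f_def s_def[symmetric] distrib_left L .
  have high: "pcong 3 (P * (\<Sum>k<m. f (p - Suc k))) (P * (P * (s * asum)))"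
    using pcong_scale_2[OF sum_reduced_summand_high] unfolding f_def s_def .
  have W: "pcong 3 (P * wallis m) (s * (1 + P * H / 2 + P^2 * H^2 / 8))"
  proof -
    have eq: "s * (s * P * wallis m) = P * wallis m" using s(2) by (simp flip: mult.assoc)
    have "pcong 3 (s * (s * P * wallis m)) (s * (1 + P * H / 2 + P^2 * H^2 / 8))"
      using pcong_mult_left[OF wallis_m s(1)] unfolding s_def .
    thus ?thesis unfolding eq .
  qed
  \<comment> \<open>The unit \<open>4^m\<close> clears the power of 4 in the middle term, as in
    \<open>reduced_summand_mid\<close>; it is cancelled at the end.\<close>
  have "pcong 3 (4^m * (P * (\<Sum>j<p. f j)))
      (4^m * (s * (1 + P * H / 2 + P^2 * H^2 / 8) - s + P * (P * (- s / 2 * (3 * H^2 / 2 + asum))))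
        + (s * (1 - 2 * P * H + 2 * P^2 * H^2) + 4^m * (P * (P * (s * asum)))))"
  proof -
    have "pcong 3 (P * (\<Sum>j<m. f j)) (s * (1 + P * H / 2 + P^2 * H^2 / 8) - s + P * (P * (- s / 2 * (3 * H^2 / 2 + asum))))"
      using low by (rule pcong_trans) (intro pcong_add pcong_diff W pcong_refl)
    moreover have "4^m * (P * (\<Sum>j<p. f j)) =
        4^m * (P * (\<Sum>j<m. f j)) + (4^m * reduced_summand p m + 4^m * (P * (\<Sum>k<m. f (p - Suc k))))"
      unfolding split by (simp only: distrib_left)
    ultimately show ?thesis
      by (simp only:, intro pcong_add[OF pcong_mult_left pcong_add[OF reduced_summand_mid[folded s_def] pcong_mult_left[OF high]]], simp_all)
  qed
  also have "\<dots> = s * (4^m * y + (1 - 2 * P * H + 2 * P^2 * H^2))"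
    by (simp add: y_def field_simps power2_eq_square)
  also have "pcong 3 \<dots> (s * (g * y + (1 - 2 * P * H + 2 * P^2 * H^2)))"
    using four_power_m s yp by (intro pcong_mult_left pcong_add pcong_mult_right) (auto simp: g_def)
  also have "g * y + (1 - 2 * P * H + 2 * P^2 * H^2) = (1 - 3 * P * H / 2 + 9 * P^2 * H^2 / 8 + P^2 * asum / 2) +
      P^3 * (- H / 2 * (- 5 * H^2 / 8 + asum / 2) + H^3 / 16 + P * (- 5 * H^4 / 64 + H^2 * asum / 16))"
    by (simp add: g_def y_def field_simps eval_nat_numeral)
  also have "pcong 3 (s * \<dots>) (s * (1 - 3 * P * H / 2 + 9 * P^2 * H^2 / 8 + P^2 * asum / 2))"
    using s by (intro pcong_mult_left pcongI[OF refl]) simp_all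
  also have "pcong 3 \<dots> (s * (g^3 * (1 + P^2 * asum / 2)))"
  proof (rule pcong_mult_left[OF pcong_sym])
    \<comment> \<open>\<open>g\<close> truncates \<open>exp(-P*H/2)\<close>, so \<open>g^3\<close>
      truncates \<open>exp(-3*P*H/2)\<close>, whence the coefficients \<open>3/2\<close> and
      \<open>9/8\<close>; \<open>r\<close> is the exact remainder.\<close>
    define r where "r = H^3 * (- 3 / 8 + 3 * P * H / 64 - (1 - P * H / 4)^3 / 8)"
    have g3: "g^3 = 1 - 3 * P * H / 2 + 9 * P^2 * H^2 / 8 + P^3 * r"
      by (simp add: g_def r_def field_simps eval_nat_numeral)
    have r: "r \<in> pint" by (simp add: r_def)
    show "pcong 3 (g^3 * (1 + P^2 * asum / 2)) (1 - 3 * P * H / 2 + 9 * P^2 * H^2 / 8 + P^2 * asum / 2)"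
    proof (rule pcongI)
      show "g^3 * (1 + P^2 * asum / 2) = 1 - 3 * P * H / 2 + 9 * P^2 * H^2 / 8 + P^2 * asum / 2 +
          P^3 * (r * (1 + P^2 * asum / 2) + (- 3 * H / 2 + 9 * P * H^2 / 8) * asum / 2)"
        unfolding g3 by (simp add: field_simps eval_nat_numeral)
      show "r * (1 + P^2 * asum / 2) + (- 3 * H / 2 + 9 * P * H^2 / 8) * asum / 2 \<in> pint"
        using r pint_minus[of 3] by simp
    qed
  qed (rule s)
  also have "pcong 3 \<dots> (s * ((4^m)^3 * (1 + P^2 * asum / 2)))"
  proof (intro pcong_mult_left pcong_mult_right)
    have c: "pcong 3 g (4^m)" using four_power_m unfolding g_def by (rule pcong_sym)
    show "pcong 3 (g^3) ((4^m)^3)"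
      unfolding power3_eq_cube using gp by (intro pcong_mult c) simp_all
  qed (use s in simp_all)
  also have "s * ((4^m)^3 * (1 + P^2 * asum / 2)) = 4^m * (4^(2*m) * (s * (1 + P^2 * asum / 2)))"
  proof -
    have "(4^m)^3 = (4^m * 4^(2*m) :: rat)"
      by (simp only: power_mult[symmetric] power_add[symmetric]) (simp add: mult.commute)
    thus ?thesis by (simp only: mult_ac)
  qed
  finally show ?thesis unfolding f_def s_def by (rule pcong_cancel) simp
qed

text \<open>The prefactor simplifies to \<open>P^2 * C / 4^(2*m)\<close>. One \<open>P\<close> goes
  into \<open>sum_reduced_summand\<close>, whose power of 4 cancels; the other lifts the congruence
  from \<open>p^3\<close> to \<open>p^4\<close>.\<close>

lemma sum_franel:
  "pcong 4 (\<Sum>k<p. of_nat ((2 * k) choose k) * (of_nat (3 * k + 1) / (-16) ^ k) * of_nat (franel k))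
     ((-1)^m * P + P^3 * euler_number (p - 3))"
proof -
  define C where "C = (of_nat ((2 * p - 1) choose (p - 1)) :: rat)"
  define T where "T = (\<Sum>j<p. reduced_summand p j / (2 * of_nat j + 1))"
  define s where "s = ((-1)^m :: rat)"
  have s: "s \<in> pint" unfolding s_def by simp
  have pp: "2 * p = Suc (2 * p - 1)" "p = Suc (p - 1)" using P_nonzero(2) by simp_all
  have "P * of_nat ((2 * p) choose p) = 2 * P * C"
    using binomial_rat_Suc_Suc[of "p - 1" "2 * p - 1"] pp unfolding C_def
    by (metis of_nat_Suc of_nat_mult of_nat_numeral add.commute)
  hence bin: "of_nat ((2 * p) choose p) = 2 * C" using P_nonzero(1) by simp
  have four: "(4::rat)^p = 4 * 4^(2*m)" by (simp add: p_eq)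
  have "(\<Sum>k<p. of_nat ((2 * k) choose k) * (of_nat (3 * k + 1) / (-16) ^ k) * of_nat (franel k)) =
      P * (C * (P * T) / 4^(2*m))"
    unfolding sum_franel_eq_reduced_summand bin four T_def[symmetric] by (simp add: power2_eq_square)
  also have "pcong 4 \<dots> (P * (1 * (4^(2*m) * (s * (1 + P^2 * asum / 2))) / 4^(2*m)))"
  proof -
    have C: "pcong 3 C 1" unfolding C_def by (rule wolstenholme)
    have T: "pcong 3 (P * T) (4^(2*m) * (s * (1 + P^2 * asum / 2)))"
      unfolding T_def s_def by (rule sum_reduced_summand)
    have "P * T \<in> pint" using T by (rule pcong_pint) (use s in simp)
    thus ?thesis by (intro pcong_scale_3 pcong_divide pcong_mult[OF C T]) simp_all
  qed
  also have "\<dots> = s * P + P * (P * (P * (s * asum / 2)))"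
  proof -
    have "1 * (4^(2*m) * x) / 4^(2*m) = x" for x :: rat by simp
    thus ?thesis by (simp only:) (simp add: power2_eq_square distrib_left mult_ac)
  qed
  \<comment> \<open>The congruence for the Euler number holds only modulo \<open>p\<close>; the
    three outer factors \<open>P\<close> raise it to \<open>p^4\<close>.\<close>
  also have "pcong 4 \<dots> (s * P + P * (P * (P * euler_number (p - 3))))"
    using pcong_sym[OF euler_number_pcong] unfolding s_def
    by (intro pcong_add[OF pcong_refl] pcong_scale_3 pcong_scale_2 pcong_scale_1)
  finally show ?thesis by (simp add: s_def power3_eq_cube mult_ac)
qed

end

theorem theorem1p1:
  fixes p :: nat
  assumes "prime p" and "p > 3"
  shows "rat_cong p 4
    (\<Sum>k=0..p-1. of_nat ((2 * k) choose k) * (of_nat (3 * k + 1) / (-16) ^ k) * of_nat (franel k))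
    ((-1) ^ ((p - 1) div 2) * of_nat p + of_nat p ^ 3 * euler_number (p - 3))"
proof -
  have "odd p" using assms prime_odd_nat by auto
  then obtain m where m: "p = 2 * m + 1" by (elim oddE)
  interpret prime_gt_3 p m
    by standard (use assms m in auto)
  have range: "{0..p-1} = {..<p}" using assms(2) by auto
  have half: "(p - 1) div 2 = m" using m by simp
  show ?thesis
    unfolding range half by (rule rat_congI[OF _ sum_franel]) simp
qed

end
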